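(* Let $\sigma>0$, $c\in\mathbb{R}$ and $\mu\in\mathcal{S}'(\mathbb{R})$. Let $\{Z(t):t\ge0\}$ be a process with sample paths in $C([0,\infty),\mathcal{S}'(\mathbb{R}))$ solving the following martingale problem: for all $G\in C^\infty(\mathbb{R})$ and $f\in\mathcal{S}(\mathbb{R})$, $$G(\langle Z(t),f\rangle)=G(\langle\mu,f\rangle)+\int_0^tG'(\langle Z(s),f\rangle)\langle Z(s),Af\rangle\,ds+\frac{\sigma^2}{2}\int_0^tG''(\langle Z(s),f\rangle)f(c)^2\,ds+\text{martingale}.$$ Then the Langevin type stochastic equation $$\langle Z(t),f\rangle=\langle\mu,f\rangle+\sigma B(t)f(c)+\int_0^t\langle Z(s),Af\rangle\,ds,\qquad t\ge0,\ f\in\mathcal{S}(\mathbb{R}),$$ holds, where $\{B(t):t\ge0\}$ is a standard one-dimensional Brownian motion.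
   Context: $\mathcal{S}(\mathbb{R})$ is the Schwartz space of rapidly decreasing functions, $\mathcal{S}'(\mathbb{R})$ its dual with the strong topology, $\langle\cdot,\cdot\rangle$ the duality pairing. $A=\frac12\frac{d^2}{dx^2}$. $C^\infty(\mathbb{R})$ is the set of bounded infinitely differentiable functions on $\mathbb{R}$ with bounded derivatives. In the martingale problem "martingale" means a martingale null at time $0$ (so $Z(0)=\mu$), with respect to the natural filtration of $Z$. *)

theory Defs
  imports "HOL-Probability.Probability"
begin

definition smooth :: "(real \<Rightarrow> real) \<Rightarrow> bool" where
  "smooth f \<longleftrightarrow> (\<forall>n x. (deriv ^^ n) f differentiable (at x))"

text \<open>The class written \<open>C\<^sup>\<infinity>(\<real>)\<close> in the martingale problem; the case \<open>n = 0\<close> says that \<open>G\<close> itself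
  is bounded.\<close>

definition smooth_bounded :: "(real \<Rightarrow> real) \<Rightarrow> bool" where
  "smooth_bounded G \<longleftrightarrow> smooth G \<and> (\<forall>n. bounded (range ((deriv ^^ n) G)))"

lemma smooth_has_deriv:
  assumes "smooth f"
  shows "((deriv ^^ n) f has_real_derivative (deriv ^^ Suc n) f x) (at x)"
  using assms by (simp add: smooth_def DERIV_deriv_iff_real_differentiable)

lemma higher_deriv_add:
  assumes "smooth f" "smooth g"
  shows "(deriv ^^ n) (\<lambda>x. f x + g x) = (\<lambda>x. (deriv ^^ n) f x + (deriv ^^ n) g x)"
proof (induction n)
  case (Suc n)
  have "deriv (\<lambda>x. (deriv ^^ n) f x + (deriv ^^ n) g x) x
      = (deriv ^^ Suc n) f x + (deriv ^^ Suc n) g x" for x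
    by (rule DERIV_imp_deriv) (intro DERIV_add smooth_has_deriv assms)
  with Suc show ?case by auto
qed simp

lemma higher_deriv_cmult:
  assumes "smooth f"
  shows "(deriv ^^ n) (\<lambda>x. c * f x) = (\<lambda>x. c * (deriv ^^ n) f x)"
proof (induction n)
  case (Suc n)
  have "deriv (\<lambda>x. c * (deriv ^^ n) f x) x = c * (deriv ^^ Suc n) f x" for x
    by (rule DERIV_imp_deriv) (intro DERIV_cmult smooth_has_deriv assms)
  with Suc show ?case by auto
qed simp

lemma smooth_add:
  assumes "smooth f" "smooth g"
  shows "smooth (\<lambda>x. f x + g x)"
  unfolding smooth_def higher_deriv_add[OF assms]
  using assms by (auto simp: smooth_def intro!: differentiable_add)

lemma smooth_cmult:
  assumes "smooth f"
  shows "smooth (\<lambda>x. c * f x)"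
  unfolding smooth_def higher_deriv_cmult[OF assms]
  using assms by (auto simp: smooth_def intro!: differentiable_mult)

lemma smooth_deriv:
  assumes "smooth f"
  shows "smooth (deriv f)"
proof -
  have "(deriv ^^ n) (deriv f) = (deriv ^^ Suc n) f" for n
    by (simp add: funpow_swap1)
  with assms show ?thesis by (simp add: smooth_def del: funpow.simps)
qed

definition rapidly_decreasing :: "(real \<Rightarrow> real) \<Rightarrow> bool" where
  "rapidly_decreasing f \<longleftrightarrow>
    smooth f \<and> (\<forall>k m. bounded (range (\<lambda>x. x ^ k * (deriv ^^ m) f x)))"

lemma rapidly_decreasing_add:
  assumes "rapidly_decreasing f" "rapidly_decreasing g"
  shows "rapidly_decreasing (\<lambda>x. f x + g x)"
proof -
  have s: "smooth f" "smooth g" using assms by (auto simp: rapidly_decreasing_def)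
  have "bounded (range (\<lambda>x. x ^ k * (deriv ^^ m) f x + x ^ k * (deriv ^^ m) g x))" for k m
    using assms by (intro bounded_plus_comp) (auto simp: rapidly_decreasing_def)
  then show ?thesis
    using smooth_add[OF s]
    by (simp add: rapidly_decreasing_def higher_deriv_add[OF s] distrib_left)
qed

lemma rapidly_decreasing_cmult:
  assumes "rapidly_decreasing f"
  shows "rapidly_decreasing (\<lambda>x. c * f x)"
proof -
  have s: "smooth f" using assms by (auto simp: rapidly_decreasing_def)
  have "bounded (range (\<lambda>x. c *\<^sub>R (x ^ k * (deriv ^^ m) f x)))" for k m
    using assms by (intro bounded_scaleR_comp) (auto simp: rapidly_decreasing_def)
  then show ?thesis
    using smooth_cmult[OF s]
    by (simp add: rapidly_decreasing_def higher_deriv_cmult[OF s] mult.left_commute)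
qed

lemma rapidly_decreasing_deriv:
  assumes "rapidly_decreasing f"
  shows "rapidly_decreasing (deriv f)"
proof -
  have "(deriv ^^ m) (deriv f) = (deriv ^^ Suc m) f" for m
    by (simp add: funpow_swap1)
  with assms show ?thesis
    by (simp add: rapidly_decreasing_def smooth_deriv del: funpow.simps)
qed

lemma rapidly_decreasing_zero: "rapidly_decreasing (\<lambda>x. 0)"
proof -
  have "(deriv ^^ n) (\<lambda>x::real. 0::real) = (\<lambda>x. 0)" for n
    by (induction n) auto
  then show ?thesis by (simp add: rapidly_decreasing_def smooth_def)
qed

typedef schwartz = "{f. rapidly_decreasing f}"
  morphisms schwartz_fun Schwartz
  using rapidly_decreasing_zero by blast

setup_lifting type_definition_schwartz

instantiation schwartz :: real_vector
begin

lift_definition zero_schwartz :: schwartz is "\<lambda>x. 0"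
  by (rule rapidly_decreasing_zero)

lift_definition plus_schwartz :: "schwartz \<Rightarrow> schwartz \<Rightarrow> schwartz"
  is "\<lambda>f g x. f x + g x"
  by (rule rapidly_decreasing_add)

lift_definition scaleR_schwartz :: "real \<Rightarrow> schwartz \<Rightarrow> schwartz"
  is "\<lambda>c f x. c * f x"
  by (rule rapidly_decreasing_cmult)

definition uminus_schwartz :: "schwartz \<Rightarrow> schwartz" where
  "uminus_schwartz f = (-1) *\<^sub>R f"

definition minus_schwartz :: "schwartz \<Rightarrow> schwartz \<Rightarrow> schwartz" where
  "minus_schwartz f g = f + (- g)"

instance
  by (intro_classes; (unfold minus_schwartz_def uminus_schwartz_def)?; transfer;
      simp add: algebra_simps)

end

lift_definition schwartz_deriv :: "schwartz \<Rightarrow> schwartz" is deriv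
  by (rule rapidly_decreasing_deriv)

definition schwartz_A :: "schwartz \<Rightarrow> schwartz" where
  "schwartz_A f = (1/2) *\<^sub>R schwartz_deriv (schwartz_deriv f)"

definition schwartz_seminorm :: "nat \<Rightarrow> nat \<Rightarrow> schwartz \<Rightarrow> real" where
  "schwartz_seminorm k m f = (SUP x. \<bar>x ^ k * (deriv ^^ m) (schwartz_fun f) x\<bar>)"

text \<open>The locally convex topology generated by the seminorms. Finitely many of them are
  collected into the family with indices up to \<open>N\<close>.\<close>

instantiation schwartz :: topological_space
begin

definition open_schwartz :: "schwartz set \<Rightarrow> bool" where
  "open_schwartz U \<longleftrightarrow> (\<forall>f\<in>U. \<exists>N. \<exists>e>0.
      {g. \<forall>k\<le>N. \<forall>m\<le>N. schwartz_seminorm k m (g - f) < e} \<subseteq> U)"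

instance
proof
  show "open (UNIV :: schwartz set)"
    by (auto simp: open_schwartz_def intro: exI[of _ 1])
next
  fix S T :: "schwartz set"
  assume ST: "open S" "open T"
  show "open (S \<inter> T)"
    unfolding open_schwartz_def
  proof
    fix f assume "f \<in> S \<inter> T"
    with ST obtain N1 e1 N2 e2
      where "e1 > 0" "{g. \<forall>k\<le>N1. \<forall>m\<le>N1. schwartz_seminorm k m (g - f) < e1} \<subseteq> S"
        and "e2 > 0" "{g. \<forall>k\<le>N2. \<forall>m\<le>N2. schwartz_seminorm k m (g - f) < e2} \<subseteq> T"
      unfolding open_schwartz_def by (meson IntE)
    then have "min e1 e2 > 0"
      and "{g. \<forall>k\<le>max N1 N2. \<forall>m\<le>max N1 N2. schwartz_seminorm k m (g - f) < min e1 e2} \<subseteq> S \<inter> T"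
      by auto
    then show "\<exists>N. \<exists>e>0. {g. \<forall>k\<le>N. \<forall>m\<le>N. schwartz_seminorm k m (g - f) < e} \<subseteq> S \<inter> T"
      by blast
  qed
next
  fix K :: "schwartz set set"
  assume K: "\<forall>S\<in>K. open S"
  show "open (\<Union>K)"
    unfolding open_schwartz_def
  proof
    fix f assume "f \<in> \<Union>K"
    then obtain S where S: "S \<in> K" "f \<in> S" by blast
    with K obtain N e where "e > 0" "{g. \<forall>k\<le>N. \<forall>m\<le>N. schwartz_seminorm k m (g - f) < e} \<subseteq> S"
      unfolding open_schwartz_def by meson
    with S show "\<exists>N. \<exists>e>0. {g. \<forall>k\<le>N. \<forall>m\<le>N. schwartz_seminorm k m (g - f) < e} \<subseteq> \<Union>K"
      by blast
  qed
qed

end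

typedef tempered = "{u :: schwartz \<Rightarrow> real. linear u \<and> continuous_on UNIV u}"
  morphisms pairing Tempered
  by (rule exI[of _ "\<lambda>f. 0"]) (auto simp: linear_iff)

text \<open>Bounded subsets of a locally convex space: those on which every defining seminorm is
  bounded.\<close>

definition schwartz_bounded :: "schwartz set \<Rightarrow> bool" where
  "schwartz_bounded B \<longleftrightarrow> (\<forall>k m. \<exists>C. \<forall>f\<in>B. schwartz_seminorm k m f \<le> C)"

lemma schwartz_bounded_Un:
  assumes "schwartz_bounded B" "schwartz_bounded B'"
  shows "schwartz_bounded (B \<union> B')"
  unfolding schwartz_bounded_def
proof (intro allI)
  fix k m
  from assms obtain C C' where
    "\<forall>f\<in>B. schwartz_seminorm k m f \<le> C" "\<forall>f\<in>B'. schwartz_seminorm k m f \<le> C'"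
    unfolding schwartz_bounded_def by meson
  then show "\<exists>C. \<forall>f\<in>B \<union> B'. schwartz_seminorm k m f \<le> C"
    by (intro exI[of _ "max C C'"]) auto
qed

text \<open>Strong topology: uniform convergence on the bounded subsets of the Schwartz space. Since
  bounded sets are closed under finite unions, one bounded set at a time gives a base.\<close>

instantiation tempered :: topological_space
begin

definition open_tempered :: "tempered set \<Rightarrow> bool" where
  "open_tempered U \<longleftrightarrow> (\<forall>u\<in>U. \<exists>B. schwartz_bounded B \<and>
      (\<exists>e>0. {v. \<forall>f\<in>B. \<bar>pairing v f - pairing u f\<bar> < e} \<subseteq> U))"

instance
proof
  show "open (UNIV :: tempered set)"
    by (auto simp: open_tempered_def schwartz_bounded_def intro!: exI[of _ "{}"] exI[of _ 1])
next
  fix S T :: "tempered set"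
  assume ST: "open S" "open T"
  show "open (S \<inter> T)"
    unfolding open_tempered_def
  proof
    fix u assume "u \<in> S \<inter> T"
    with ST obtain B1 e1 B2 e2
      where "schwartz_bounded B1" "schwartz_bounded B2"
        and "e1 > 0" "{v. \<forall>f\<in>B1. \<bar>pairing v f - pairing u f\<bar> < e1} \<subseteq> S"
        and "e2 > 0" "{v. \<forall>f\<in>B2. \<bar>pairing v f - pairing u f\<bar> < e2} \<subseteq> T"
      unfolding open_tempered_def by (meson IntE)
    then have "schwartz_bounded (B1 \<union> B2)" "min e1 e2 > 0"
      and "{v. \<forall>f\<in>B1 \<union> B2. \<bar>pairing v f - pairing u f\<bar> < min e1 e2} \<subseteq> S \<inter> T"
      by (auto intro: schwartz_bounded_Un)
    then show "\<exists>B. schwartz_bounded B \<and>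
        (\<exists>e>0. {v. \<forall>f\<in>B. \<bar>pairing v f - pairing u f\<bar> < e} \<subseteq> S \<inter> T)"
      by blast
  qed
next
  fix K :: "tempered set set"
  assume K: "\<forall>S\<in>K. open S"
  show "open (\<Union>K)"
    unfolding open_tempered_def
  proof
    fix u assume "u \<in> \<Union>K"
    then obtain S where S: "S \<in> K" "u \<in> S" by blast
    with K obtain B e where "schwartz_bounded B" "e > 0"
        "{v. \<forall>f\<in>B. \<bar>pairing v f - pairing u f\<bar> < e} \<subseteq> S"
      unfolding open_tempered_def by meson
    with S show "\<exists>B. schwartz_bounded B \<and>
        (\<exists>e>0. {v. \<forall>f\<in>B. \<bar>pairing v f - pairing u f\<bar> < e} \<subseteq> \<Union>K)"
      by blast
  qed
qed

end

text \<open>For \<open>X\<close> with values in \<^typ>\<open>tempered\<close>, \<open>borel\<close> is the Borel \<open>\<sigma>\<close>-algebra of the strong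
  topology. The filtration is the raw one, neither completed nor made right-continuous.\<close>

definition natural_filtration ::
    "'w measure \<Rightarrow> (real \<Rightarrow> 'w \<Rightarrow> 'b::topological_space) \<Rightarrow> real \<Rightarrow> 'w measure" where
  "natural_filtration M X t =
    sigma (space M) {X s -` A \<inter> space M | s A. 0 \<le> s \<and> s \<le> t \<and> A \<in> sets borel}"

definition martingale ::
    "'w measure \<Rightarrow> (real \<Rightarrow> 'w measure) \<Rightarrow> (real \<Rightarrow> 'w \<Rightarrow> real) \<Rightarrow> bool" where
  "martingale M F N \<longleftrightarrow>
    (\<forall>t\<ge>0. N t \<in> borel_measurable (F t) \<and> integrable M (N t)) \<and>
    (\<forall>s t. 0 \<le> s \<and> s \<le> t \<longrightarrow> (AE \<omega> in M. real_cond_exp M (F s) (N t) \<omega> = N s \<omega>))"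

definition martingale_null_at_0 ::
    "'w measure \<Rightarrow> (real \<Rightarrow> 'w measure) \<Rightarrow> (real \<Rightarrow> 'w \<Rightarrow> real) \<Rightarrow> bool" where
  "martingale_null_at_0 M F N \<longleftrightarrow> martingale M F N \<and> (AE \<omega> in M. N 0 \<omega> = 0)"

definition brownian_motion :: "'w measure \<Rightarrow> (real \<Rightarrow> 'w \<Rightarrow> real) \<Rightarrow> bool" where
  "brownian_motion M B \<longleftrightarrow>
    (\<forall>t\<ge>0. B t \<in> borel_measurable M) \<and>
    (\<forall>\<omega>\<in>space M. B 0 \<omega> = 0 \<and> continuous_on {0..} (\<lambda>t. B t \<omega>)) \<and>
    (\<forall>s t. 0 \<le> s \<and> s < t \<longrightarrow>
      distributed M lborel (\<lambda>\<omega>. B t \<omega> - B s \<omega>) (normal_density 0 (sqrt (t - s)))) \<and>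
    (\<forall>n (\<tau> :: nat \<Rightarrow> real). 0 \<le> \<tau> 0 \<and> (\<forall>i<n. \<tau> i \<le> \<tau> (Suc i)) \<longrightarrow>
      prob_space.indep_vars M (\<lambda>_. borel) (\<lambda>i \<omega>. B (\<tau> (Suc i)) \<omega> - B (\<tau> i) \<omega>) {..<n})"

definition solves_martingale_problem ::
    "'w measure \<Rightarrow> real \<Rightarrow> real \<Rightarrow> tempered \<Rightarrow> (real \<Rightarrow> 'w \<Rightarrow> tempered) \<Rightarrow> bool" where
  "solves_martingale_problem M \<sigma> c \<mu> Z \<longleftrightarrow>
    (\<forall>G f. smooth_bounded G \<longrightarrow>
      martingale_null_at_0 M (natural_filtration M Z) (\<lambda>t \<omega>.
        G (pairing (Z t \<omega>) f) - G (pairing \<mu> f)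
        - (LBINT s:{0..t}. deriv G (pairing (Z s \<omega>) f) * pairing (Z s \<omega>) (schwartz_A f))
        - \<sigma>\<^sup>2 / 2 * (LBINT s:{0..t}. deriv (deriv G) (pairing (Z s \<omega>) f) * (schwartz_fun f c)\<^sup>2)))"

end

theory Submission
  imports Defs "HOL-Computational_Algebra.Polynomial"
begin

text \<open>
  Put \<open>X = \<langle>Z, f\<rangle>\<close>, \<open>a = \<langle>Z, Af\<rangle>\<close>, \<open>R = X - \<integral>a\<close> and \<open>v = \<sigma>\<^sup>2 f(c)\<^sup>2\<close>. The test functions
  \<open>cos (\<theta>x + \<phi>)\<close> alone suffice. Multiplying the martingale of such a \<open>G\<close> by a process \<open>W\<close> of finite
  variation and integrating by parts, one shows that \<open>exp (\<theta>\<^sup>2 v t / 2) cos (\<theta> R + \<phi>)\<close> is a martingale.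
  Since \<open>a\<close> need not be integrable over the probability space, \<open>W\<close> carries an additional factor
  \<open>exp (- \<epsilon> \<integral>\<bar>a\<bar>)\<close>; all terms are then bounded pathwise, and \<open>\<epsilon> \<rightarrow> 0\<close> by dominated convergence.

  Hence, given the past, an increment of \<open>R\<close> over \<open>[s, t]\<close> has characteristic function
  \<open>exp (- \<theta>\<^sup>2 v (t - s) / 2)\<close>, so by Levy's uniqueness theorem \<open>R\<close> is \<open>\<surd>v\<close> times a Brownian motion, or
  constant if \<open>f(c) = 0\<close>. Take \<open>B\<close> from some \<open>f\<^sub>0\<close> with \<open>f\<^sub>0(c) = 1\<close>; as \<open>f - f(c) f\<^sub>0\<close> vanishes at \<open>c\<close>, the
  equation holds almost surely for each \<open>f\<close>. It holds simultaneously for all \<open>f\<close> because the Schwartz space is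
  separable and both sides are continuous along convergent sequences, strong continuity of the
  paths bounding \<open>\<langle>Z(s), Af\<^sub>n\<rangle>\<close> uniformly in \<open>n\<close> and \<open>s \<le> t\<close>.
\<close>

section \<open>Schwartz functions and tempered distributions\<close>

lemma smooth_schwartz_fun: "smooth (schwartz_fun f)"
  using schwartz_fun[of f] by (simp add: rapidly_decreasing_def)

lemma schwartz_seminorm_upper: "\<bar>x ^ k * (deriv ^^ m) (schwartz_fun f) x\<bar> \<le> schwartz_seminorm k m f"
proof -
  have "bounded (range (\<lambda>x. x ^ k * (deriv ^^ m) (schwartz_fun f) x))"
    using schwartz_fun[of f] by (simp add: rapidly_decreasing_def)
  then have "bdd_above (range (\<lambda>x. \<bar>x ^ k * (deriv ^^ m) (schwartz_fun f) x\<bar>))"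
    by (auto simp: bounded_iff bdd_above_def)
  then show ?thesis unfolding schwartz_seminorm_def by (rule cSUP_upper[OF UNIV_I])
qed

lemma schwartz_seminorm_least:
  "(\<And>x. \<bar>x ^ k * (deriv ^^ m) (schwartz_fun f) x\<bar> \<le> C) \<Longrightarrow> schwartz_seminorm k m f \<le> C"
  unfolding schwartz_seminorm_def by (rule cSUP_least) auto

lemma schwartz_seminorm_nonneg: "0 \<le> schwartz_seminorm k m f"
  using schwartz_seminorm_upper[of 0 k m f] by (meson abs_ge_zero order_trans)

lemma higher_deriv_schwartz_diff:
  "(deriv ^^ m) (schwartz_fun (g - f)) x = (deriv ^^ m) (schwartz_fun g) x - (deriv ^^ m) (schwartz_fun f) x"
proof -
  have "schwartz_fun (g - f) = (\<lambda>x. schwartz_fun g x + (- 1) * schwartz_fun f x)"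
    unfolding minus_schwartz_def uminus_schwartz_def plus_schwartz.rep_eq scaleR_schwartz.rep_eq ..
  then show ?thesis
    by (simp only: higher_deriv_add[OF smooth_schwartz_fun smooth_cmult[OF smooth_schwartz_fun]]
        higher_deriv_cmult[OF smooth_schwartz_fun])
qed

lemma schwartz_fun_A: "schwartz_fun (schwartz_A f) x = 1 / 2 * (deriv ^^ 2) (schwartz_fun f) x"
  unfolding schwartz_A_def scaleR_schwartz.rep_eq schwartz_deriv.rep_eq by (simp add: numeral_2_eq_2)

lemma higher_deriv_schwartz_A:
  "(deriv ^^ m) (schwartz_fun (schwartz_A f)) x = 1 / 2 * (deriv ^^ (m + 2)) (schwartz_fun f) x"
proof -
  have "(deriv ^^ m) (schwartz_fun (schwartz_A f)) = (deriv ^^ m) (\<lambda>x. 1 / 2 * (deriv ^^ 2) (schwartz_fun f) x)"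
    by (simp add: schwartz_fun_A[abs_def])
  also have "\<dots> = (\<lambda>x. 1 / 2 * (deriv ^^ m) ((deriv ^^ 2) (schwartz_fun f)) x)"
    by (rule higher_deriv_cmult)
      (simp add: numeral_2_eq_2 smooth_deriv smooth_schwartz_fun)
  finally show ?thesis by (simp only: funpow_add o_apply)
qed

lemma schwartz_A_diff: "schwartz_A (g - f) = schwartz_A g - schwartz_A f"
proof -
  have "schwartz_fun (schwartz_A (g - f)) x = schwartz_fun (schwartz_A g - schwartz_A f) x" for x
    using higher_deriv_schwartz_diff[of 0 "schwartz_A g" "schwartz_A f" x] higher_deriv_schwartz_diff[of 2 g f x]
    by (simp add: schwartz_fun_A right_diff_distrib)
  then show ?thesis by (simp add: schwartz_fun_inject[symmetric] fun_eq_iff)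
qed

lemma schwartz_A_scaleR: "schwartz_A (b *\<^sub>R f) = b *\<^sub>R schwartz_A f"
proof -
  have "schwartz_fun (schwartz_A (b *\<^sub>R f)) x = schwartz_fun (b *\<^sub>R schwartz_A f) x" for x
    by (simp add: schwartz_fun_A scaleR_schwartz.rep_eq higher_deriv_cmult[OF smooth_schwartz_fun] del: funpow.simps)
  then show ?thesis by (simp add: schwartz_fun_inject[symmetric] fun_eq_iff)
qed

text \<open>Two derivatives raise the derivative index by two, and the factor 1/2 only helps. This
  is continuity of \<open>A\<close> at the level of seminorms.\<close>

lemma schwartz_seminorm_A_le: "schwartz_seminorm k m (schwartz_A f) \<le> schwartz_seminorm k (m + 2) f"
proof (rule schwartz_seminorm_least)
  fix x
  have "\<bar>x ^ k * (deriv ^^ m) (schwartz_fun (schwartz_A f)) x\<bar> = 1 / 2 * \<bar>x ^ k * (deriv ^^ (m + 2)) (schwartz_fun f) x\<bar>"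
    unfolding higher_deriv_schwartz_A by (simp add: abs_mult)
  then show "\<bar>x ^ k * (deriv ^^ m) (schwartz_fun (schwartz_A f)) x\<bar> \<le> schwartz_seminorm k (m + 2) f"
    using schwartz_seminorm_upper[of x k "m + 2" f] by linarith
qed

section \<open>Convergent sequences of Schwartz functions\<close>

text \<open>Convergence is phrased by the seminorms themselves: this is the form in which
  approximating sequences are constructed, and it gives boundedness of the range and stability under
  \<open>A\<close> directly.\<close>

definition schwartz_LIMSEQ :: "(nat \<Rightarrow> schwartz) \<Rightarrow> schwartz \<Rightarrow> bool" where
  "schwartz_LIMSEQ g f \<longleftrightarrow> (\<forall>k m. (\<lambda>n. schwartz_seminorm k m (g n - f)) \<longlonglongrightarrow> 0)"

lemma schwartz_LIMSEQ_A:
  assumes "schwartz_LIMSEQ g f"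
  shows "schwartz_LIMSEQ (\<lambda>n. schwartz_A (g n)) (schwartz_A f)"
  unfolding schwartz_LIMSEQ_def
proof (intro allI)
  fix k m
  show "(\<lambda>n. schwartz_seminorm k m (schwartz_A (g n) - schwartz_A f)) \<longlonglongrightarrow> 0"
  proof (rule tendsto_sandwich[where f = "\<lambda>_. 0" and h = "\<lambda>n. schwartz_seminorm k (m + 2) (g n - f)"])
    show "(\<lambda>n. schwartz_seminorm k (m + 2) (g n - f)) \<longlonglongrightarrow> 0"
      using assms by (simp only: schwartz_LIMSEQ_def)
    show "\<forall>\<^sub>F n in sequentially. schwartz_seminorm k m (schwartz_A (g n) - schwartz_A f)
        \<le> schwartz_seminorm k (m + 2) (g n - f)"
      using schwartz_seminorm_A_le by (simp add: schwartz_A_diff[symmetric])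
  qed (simp_all add: schwartz_seminorm_nonneg)
qed

text \<open>A basic neighbourhood involves finitely many seminorms, so the eventual bounds for the
  individual ones can be combined.\<close>

lemma schwartz_LIMSEQ_tendsto:
  assumes "schwartz_LIMSEQ g f"
  shows "g \<longlonglongrightarrow> f"
proof (rule topological_tendstoI)
  fix S assume "open S" "f \<in> S"
  then obtain N e where e: "e > 0" and S: "{g. \<forall>k\<le>N. \<forall>m\<le>N. schwartz_seminorm k m (g - f) < e} \<subseteq> S"
    unfolding open_schwartz_def by meson
  have "\<forall>\<^sub>F n in sequentially. \<forall>k\<in>{..N}. \<forall>m\<in>{..N}. schwartz_seminorm k m (g n - f) < e"
    using assms e by (intro eventually_ball_finite finite_atMost ballI order_tendstoD(2))
      (auto simp: schwartz_LIMSEQ_def)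
  then show "\<forall>\<^sub>F n in sequentially. g n \<in> S"
    by eventually_elim (use S in auto)
qed

text \<open>This is what couples sequences to the strong topology: the range of a convergent
  sequence is one of the sets on which that topology controls distributions uniformly.\<close>

lemma schwartz_LIMSEQ_bounded:
  assumes "schwartz_LIMSEQ g f"
  shows "schwartz_bounded (range g)"
  unfolding schwartz_bounded_def
proof (intro allI)
  fix k m
  have "Bseq (\<lambda>n. schwartz_seminorm k m (g n - f))"
    using assms convergentI[THEN convergent_imp_Bseq] unfolding schwartz_LIMSEQ_def by blast
  then obtain C where C: "\<And>n. norm (schwartz_seminorm k m (g n - f)) \<le> C" by (auto simp: Bseq_def)
  show "\<exists>C. \<forall>h\<in>range g. schwartz_seminorm k m h \<le> C"
  proof (intro exI[of _ "C + schwartz_seminorm k m f"] ballI)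
    fix h assume "h \<in> range g"
    then obtain n where n: "h = g n" by auto
    show "schwartz_seminorm k m h \<le> C + schwartz_seminorm k m f"
      unfolding n
    proof (rule schwartz_seminorm_least)
      fix x
      have "x ^ k * (deriv ^^ m) (schwartz_fun (g n)) x
          = x ^ k * (deriv ^^ m) (schwartz_fun (g n - f)) x + x ^ k * (deriv ^^ m) (schwartz_fun f) x"
        by (simp add: higher_deriv_schwartz_diff algebra_simps)
      then show "\<bar>x ^ k * (deriv ^^ m) (schwartz_fun (g n)) x\<bar> \<le> C + schwartz_seminorm k m f"
        using schwartz_seminorm_upper[of x k m "g n - f"] schwartz_seminorm_upper[of x k m f] C[of n]
        by simp
    qed
  qed
qed

lemma schwartz_LIMSEQ_eval:
  assumes "schwartz_LIMSEQ g f"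
  shows "(\<lambda>n. schwartz_fun (g n) c) \<longlonglongrightarrow> schwartz_fun f c"
proof (rule LIM_zero_cancel, rule Lim_null_comparison)
  show "(\<lambda>n. schwartz_seminorm 0 0 (g n - f)) \<longlonglongrightarrow> 0"
    using assms by (simp add: schwartz_LIMSEQ_def)
  show "\<forall>\<^sub>F n in sequentially. norm (schwartz_fun (g n) c - schwartz_fun f c) \<le> schwartz_seminorm 0 0 (g n - f)"
  proof (intro always_eventually allI)
    fix n
    show "norm (schwartz_fun (g n) c - schwartz_fun f c) \<le> schwartz_seminorm 0 0 (g n - f)"
      using schwartz_seminorm_upper[of c 0 0 "g n - f"] higher_deriv_schwartz_diff[of 0 "g n" f c] by simp
  qed
qed

section \<open>The pairing and the strong topology\<close>

lemma linear_pairing: "linear (pairing u)"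
  using pairing[of u] by simp

lemma pairing_LIMSEQ:
  assumes "schwartz_LIMSEQ g f"
  shows "(\<lambda>n. pairing u (g n)) \<longlonglongrightarrow> pairing u f"
  by (rule continuous_on_tendsto_compose[OF _ schwartz_LIMSEQ_tendsto[OF assms]])
    (use pairing[of u] in auto)

text \<open>The supremum over \<open>B\<close> must stay strictly below \<open>r\<close>, hence the
  intermediate \<open>e\<close>: a pointwise strict bound over an infinite \<open>B\<close> would
  leave no uniform room. Here the room is \<open>r - e\<close>, half of which is used.\<close>

lemma open_uniform_neighbourhood:
  assumes "schwartz_bounded B"
  shows "open {v. \<exists>e<r. \<forall>f\<in>B. \<bar>pairing v f - pairing u f\<bar> \<le> e}"
  unfolding open_tempered_def
proof
  fix v assume "v \<in> {v. \<exists>e<r. \<forall>f\<in>B. \<bar>pairing v f - pairing u f\<bar> \<le> e}"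
  then obtain e where e: "e < r" "\<forall>f\<in>B. \<bar>pairing v f - pairing u f\<bar> \<le> e" by auto
  have "w \<in> {v. \<exists>e<r. \<forall>f\<in>B. \<bar>pairing v f - pairing u f\<bar> \<le> e}"
    if "\<forall>f\<in>B. \<bar>pairing w f - pairing v f\<bar> < (r - e) / 2" for w
  proof (rule CollectI, intro exI[of _ "(r + e) / 2"] conjI ballI)
    fix f assume "f \<in> B"
    then have "\<bar>pairing w f - pairing v f\<bar> < (r - e) / 2" "\<bar>pairing v f - pairing u f\<bar> \<le> e"
      using that e by auto
    then show "\<bar>pairing w f - pairing u f\<bar> \<le> (r + e) / 2" by argo
  qed (use e in simp)
  then show "\<exists>B'. schwartz_bounded B' \<and> (\<exists>d>0. {w. \<forall>f\<in>B'. \<bar>pairing w f - pairing v f\<bar> < d}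
      \<subseteq> {v. \<exists>e<r. \<forall>f\<in>B. \<bar>pairing v f - pairing u f\<bar> \<le> e})"
    using assms e by (intro exI[of _ B] conjI exI[of _ "(r - e) / 2"]) auto
qed

text \<open>A singleton is a bounded set, so evaluation at \<open>f\<close> is controlled by a
  strong neighbourhood. Path continuity and measurability of the real processes come from
  here.\<close>

lemma continuous_on_pairing: "continuous_on UNIV (\<lambda>u. pairing u f)"
  unfolding continuous_on_topological
proof (intro ballI allI impI)
  fix u and B :: "real set" assume "open B" "pairing u f \<in> B"
  then obtain r where r: "r > 0" "ball (pairing u f) r \<subseteq> B" by (auto simp: open_contains_ball)
  let ?A = "{v. \<exists>e<r. \<forall>g\<in>{f}. \<bar>pairing v g - pairing u g\<bar> \<le> e}"
  have "open ?A" by (rule open_uniform_neighbourhood) (auto simp: schwartz_bounded_def)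
  moreover have "u \<in> ?A" using r by auto
  moreover have "pairing v f \<in> B" if "v \<in> ?A" for v
    using that r by (auto simp: subset_iff dist_real_def abs_minus_commute)
  ultimately show "\<exists>A. open A \<and> u \<in> A \<and> (\<forall>v\<in>UNIV. v \<in> A \<longrightarrow> pairing v f \<in> B)"
    by (intro exI[of _ ?A]) blast
qed

text \<open>Each \<open>u\<close> is bounded along \<open>g\<close> because
  \<open>pairing u (g n)\<close> converges. Strong neighbourhoods move this bound by less than 1
  uniformly in \<open>n\<close>, and compactness leaves finitely many centres.\<close>

lemma compact_pairing_bounded:
  assumes "compact K" and g: "schwartz_LIMSEQ g f"
  shows "\<exists>C. \<forall>u\<in>K. \<forall>n. \<bar>pairing u (g n)\<bar> \<le> C"
proof -
  let ?O = "\<lambda>u. {v. \<exists>e<1. \<forall>f\<in>range g. \<bar>pairing v f - pairing u f\<bar> \<le> e}"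
  have mem: "u \<in> ?O u" for u by (auto intro!: exI[of _ 0])
  have "K \<subseteq> (\<Union>u\<in>K. ?O u)" using mem by fast
  then obtain D where D: "D \<subseteq> K" "finite D" "K \<subseteq> (\<Union>u\<in>D. ?O u)"
    by (rule compactE_image[OF assms(1) open_uniform_neighbourhood[OF schwartz_LIMSEQ_bounded[OF g]]])
  have "\<exists>C. \<forall>n. \<bar>pairing u (g n)\<bar> \<le> C" for u
    using convergent_imp_Bseq[OF convergentI[OF pairing_LIMSEQ[OF g, of u]]] by (auto simp: Bseq_def)
  then obtain C where C: "\<And>u n. \<bar>pairing u (g n)\<bar> \<le> C u" by metis
  \<comment> \<open>A sum in place of a maximum also covers an empty \<open>D\<close>.\<close>
  have "\<bar>pairing v (g n)\<bar> \<le> (\<Sum>u\<in>D. C u) + 1" if "v \<in> K" for v n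
  proof -
    obtain u e where u: "u \<in> D" "e < 1" "\<bar>pairing v (g n) - pairing u (g n)\<bar> \<le> e"
      using D(3) \<open>v \<in> K\<close> by auto
    have "0 \<le> C w" for w using C[of w 0] by linarith
    then have "C u \<le> (\<Sum>u\<in>D. C u)" using u(1) D(2) by (intro member_le_sum) auto
    then show ?thesis using u C[of u n] by linarith
  qed
  then show ?thesis by blast
qed

text \<open>Dominated convergence: the path over \<open>{0..t}\<close> has compact image, so the
  preceding bound gives a constant majorant.\<close>

lemma integral_pairing_LIMSEQ:
  fixes Z :: "real \<Rightarrow> tempered"
  assumes Z: "continuous_on {0..t} Z" and g: "schwartz_LIMSEQ g f"
  shows "(\<lambda>n. LBINT s:{0..t}. pairing (Z s) (g n)) \<longlonglongrightarrow> (LBINT s:{0..t}. pairing (Z s) f)"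
proof -
  obtain C where C: "\<And>s n. s \<in> {0..t} \<Longrightarrow> \<bar>pairing (Z s) (g n)\<bar> \<le> C"
    using compact_pairing_bounded[OF compact_continuous_image[OF Z compact_Icc] g] by (meson image_eqI)
  have meas: "(\<lambda>s. indicator {0..t} s * pairing (Z s) h) \<in> borel_measurable lborel" for h
    using borel_integrable_atLeastAtMost'[OF continuous_on_compose2[OF continuous_on_pairing Z]]
    by (simp add: set_integrable_def borel_measurable_integrable)
  have "(\<lambda>n. \<integral>s. indicator {0..t} s * pairing (Z s) (g n) \<partial>lborel)
      \<longlonglongrightarrow> (\<integral>s. indicator {0..t} s * pairing (Z s) f \<partial>lborel)"
  proof (rule integral_dominated_convergence[where w = "\<lambda>s. indicator {0..t} s * C"])
    show "AE s in lborel. (\<lambda>n. indicator {0..t} s * pairing (Z s) (g n)) \<longlonglongrightarrow> indicator {0..t} s * pairing (Z s) f"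
      by (intro AE_I2 tendsto_intros pairing_LIMSEQ[OF g])
    show "AE s in lborel. norm (indicator {0..t} s * pairing (Z s) (g n)) \<le> indicator {0..t} s * C" for n
      using C by (auto simp: indicator_def)
    show "integrable lborel (\<lambda>s. indicator {0..t} s * C)"
      using borel_integrable_atLeastAtMost'[of 0 t "\<lambda>_. C"] by (simp add: set_integrable_def)
  qed (use meas in auto)
  then show ?thesis by (simp add: set_lebesgue_integral_def)
qed

text \<open>Every derivative up to order \<open>n\<close> is sampled on a grid of mesh \<open>1/q\<close> in \<open>[-L, L]\<close> and rounded.
  Among functions whose seminorms up to index \<open>n + 1\<close> are at most \<open>K\<close>, the resulting integers determine
  the function up to \<open>1/(n + 1)\<close>: the next derivative controls it between grid points, and the next
  power of \<open>x\<close> controls it outside \<open>[-L, L]\<close>. One representative per code gives the dense set.\<close>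

lemma countable_dense_schwartz:
  obtains D :: "schwartz set"
  where "countable D" "\<And>f. \<exists>g. range g \<subseteq> D \<and> schwartz_LIMSEQ g f"
proof -
  \<comment> \<open>The difference of two functions bounded by \<open>K\<close> is bounded by
    \<open>2 * K\<close>. \<open>L\<close> makes the tail bound \<open>2 * K / L\<close> at most
    \<open>1 / (n + 1)\<close>, its last summand keeping it positive for \<open>K = 0\<close>;
    \<open>q\<close> makes \<open>L ^ n * (2 * K + 1) / q\<close> equal to
    \<open>1 / (n + 1)\<close>.\<close>
  define L :: "nat \<Rightarrow> nat \<Rightarrow> nat" where "L n K = 2 * K * (n + 1) + 1" for n K
  define q :: "nat \<Rightarrow> nat \<Rightarrow> nat" where "q n K = (2 * K + 1) * L n K ^ n * (n + 1)" for n K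
  define code :: "nat \<Rightarrow> nat \<Rightarrow> schwartz \<Rightarrow> int list list" where
    "code n K f = map (\<lambda>m. map (\<lambda>i. \<lfloor>real (q n K) * (deriv ^^ m) (schwartz_fun f) (real_of_int i / real (q n K))\<rfloor>)
      [- int (L n K * q n K)..int (L n K * q n K)]) [0..<Suc n]" for n K f
  define bd where "bd n K f \<longleftrightarrow> (\<forall>k\<le>Suc n. \<forall>m\<le>Suc n. schwartz_seminorm k m f \<le> real K)" for n K f
  \<comment> \<open>A code that no function attains yields an arbitrary representative. For the code
    of a given \<open>f\<close> with \<open>bd n K f\<close>, the function \<open>f\<close> itself
    shows that the choice is meaningful.\<close>
  define rep where "rep n K d = (SOME g. bd n K g \<and> code n K g = d)" for n K d
  have close: "schwartz_seminorm k m (rep n K (code n K f) - f) \<le> 1 / (real n + 1)"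
    if f: "bd n K f" and km: "k \<le> n" "m \<le> n" for n K f k m
  proof (rule schwartz_seminorm_least)
    fix x :: real
    define g where "g = rep n K (code n K f)"
    have "bd n K g \<and> code n K g = code n K f"
      unfolding g_def rep_def by (rule someI[of _ f]) (use f in simp)
    then have g: "bd n K g" "code n K g = code n K f" by auto
    define h where "h j y = (deriv ^^ j) (schwartz_fun g) y - (deriv ^^ j) (schwartz_fun f) y" for j y
    have h: "(deriv ^^ j) (schwartz_fun (g - f)) y = h j y" for j y
      by (simp add: h_def higher_deriv_schwartz_diff)
    have hb: "\<bar>y ^ i * h j y\<bar> \<le> 2 * real K" if "i \<le> Suc n" "j \<le> Suc n" for i j y
    proof -
      have "y ^ i * h j y = y ^ i * (deriv ^^ j) (schwartz_fun g) y - y ^ i * (deriv ^^ j) (schwartz_fun f) y"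
        by (simp add: h_def algebra_simps)
      moreover have "\<bar>y ^ i * (deriv ^^ j) (schwartz_fun g) y\<bar> \<le> K" "\<bar>y ^ i * (deriv ^^ j) (schwartz_fun f) y\<bar> \<le> K"
        using f g(1) that schwartz_seminorm_upper[of y i j] unfolding bd_def by (meson order_trans)+
      ultimately show ?thesis by linarith
    qed
    have L1: "1 \<le> real (L n K)" by (simp add: L_def)
    have q1: "0 < real (q n K)"
      unfolding q_def of_nat_0_less_iff by (intro mult_pos_pos zero_less_power) (auto simp: L_def)
    show "\<bar>x ^ k * (deriv ^^ m) (schwartz_fun (rep n K (code n K f) - f)) x\<bar> \<le> 1 / (real n + 1)"
      unfolding g_def[symmetric] h
    proof (cases "\<bar>x\<bar> \<le> real (L n K)")
      case True
      define i where "i = \<lfloor>real (q n K) * x\<rfloor>"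
      define y where "y = real_of_int i / real (q n K)"
      have "\<bar>real (q n K) * x\<bar> \<le> real (L n K) * real (q n K)"
        using True q1 by (simp add: abs_mult mult.commute)
      then have "- real (L n K * q n K) \<le> real (q n K) * x" "real (q n K) * x \<le> real (L n K * q n K)"
        by auto
      then have i: "i \<in> set [- int (L n K * q n K)..int (L n K * q n K)]"
        unfolding i_def set_upto atLeastAtMost_iff le_floor_iff floor_le_iff by (auto simp: add_strict_increasing2)
      have m: "m \<in> set [0..<Suc n]" using km by auto
      have "\<lfloor>real (q n K) * (deriv ^^ m) (schwartz_fun g) y\<rfloor> = \<lfloor>real (q n K) * (deriv ^^ m) (schwartz_fun f) y\<rfloor>"
        using g(2) m i unfolding code_def y_def map_eq_conv by blast
      then have "\<bar>real (q n K) * (deriv ^^ m) (schwartz_fun g) y - real (q n K) * (deriv ^^ m) (schwartz_fun f) y\<bar> \<le> 1"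
        by linarith
      then have "\<bar>real (q n K) * h m y\<bar> \<le> 1" by (simp add: h_def right_diff_distrib)
      then have hy: "\<bar>h m y\<bar> \<le> 1 / real (q n K)" using q1 by (simp add: abs_mult field_simps)
      have "\<bar>real (q n K) * x - real_of_int i\<bar> \<le> 1" unfolding i_def by linarith
      moreover have "x - y = (real (q n K) * x - real_of_int i) / real (q n K)"
        using q1 by (simp add: y_def field_simps)
      ultimately have xy: "\<bar>x - y\<bar> \<le> 1 / real (q n K)"
        using q1 by (simp add: abs_divide divide_right_mono)
      have "norm (h m x - h m y) \<le> (2 * real K) * norm (x - y)"
      proof (rule field_differentiable_bound[where S = UNIV and f' = "h (Suc m)"])
        show "(h m has_field_derivative h (Suc m) z) (at z within UNIV)" for z
          unfolding h_def by (intro DERIV_diff) (simp_all only: smooth_has_deriv[OF smooth_schwartz_fun])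
        show "norm (h (Suc m) z) \<le> 2 * real K" for z
          using hb[of 0 "Suc m" z] km by simp
      qed auto
      also have "\<dots> \<le> (2 * real K) * (1 / real (q n K))"
        using xy by (intro mult_left_mono) auto
      finally have "\<bar>h m x\<bar> \<le> (2 * real K) * (1 / real (q n K)) + 1 / real (q n K)"
        using hy by simp
      then have hx: "\<bar>h m x\<bar> \<le> (2 * real K + 1) / real (q n K)"
        by (simp add: add_divide_distrib)
      have "\<bar>x\<bar> ^ k \<le> real (L n K) ^ k" using True by (intro power_mono) auto
      also have "\<dots> \<le> real (L n K) ^ n" using L1 km by (intro power_increasing) auto
      finally have "\<bar>x\<bar> ^ k * \<bar>h m x\<bar> \<le> real (L n K) ^ n * ((2 * real K + 1) / real (q n K))"
        using hx by (intro mult_mono) auto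
      also have "\<dots> = 1 / (real n + 1)"
      proof -
        have cancel: "b * (a / (a * b * d)) = 1 / d" if "a \<noteq> 0" "b \<noteq> 0" for a b d :: real
          using that by simp
        have "real (q n K) = (2 * real K + 1) * real (L n K) ^ n * (real n + 1)"
          by (simp add: q_def algebra_simps)
        then show ?thesis using L1 by (simp only:) (rule cancel, auto)
      qed
      finally show "\<bar>x ^ k * h m x\<bar> \<le> 1 / (real n + 1)" by (simp add: abs_mult power_abs)
    next
      case False
      have "\<bar>x ^ k * h m x\<bar> * real (L n K) \<le> \<bar>x ^ k * h m x\<bar> * \<bar>x\<bar>"
        using False by (intro mult_left_mono) auto
      also have "\<dots> = \<bar>x ^ Suc k * h m x\<bar>" by (simp add: abs_mult mult_ac)
      also have "\<dots> \<le> 2 * real K" using hb[of "Suc k" m x] km by simp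
      finally have "\<bar>x ^ k * h m x\<bar> \<le> 2 * real K / real (L n K)" using L1 by (simp add: field_simps)
      also have "\<dots> \<le> 1 / (real n + 1)"
      proof -
        have "2 * real K * (real n + 1) \<le> real (L n K)" by (simp add: L_def algebra_simps)
        then show ?thesis using L1 by (simp add: field_simps)
      qed
      finally show "\<bar>x ^ k * h m x\<bar> \<le> 1 / (real n + 1)" .
    qed
  qed
  show ?thesis
  proof
    show "countable (range (\<lambda>(n, K, d). rep n K d))" by (rule countable_image) simp
    fix f
    have "\<exists>K. bd n K f" for n
    proof -
      let ?S = "(\<lambda>(k, m). schwartz_seminorm k m f) ` ({..Suc n} \<times> {..Suc n})"
      obtain K :: nat where K: "Max ?S \<le> real K" using real_arch_simple by blast
      have "schwartz_seminorm k m f \<le> real K" if "k \<le> Suc n" "m \<le> Suc n" for k m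
        by (rule order_trans[OF Max_ge K]) (use that in auto)
      then show ?thesis unfolding bd_def by blast
    qed
    \<comment> \<open>The bound \<open>K n\<close> may grow with \<open>n\<close>; the accuracy
      \<open>1 / (n + 1)\<close> does not depend on it.\<close>
    then obtain K where K: "\<And>n. bd n (K n) f" by metis
    let ?g = "\<lambda>n. rep n (K n) (code n (K n) f)"
    have "schwartz_LIMSEQ ?g f"
      unfolding schwartz_LIMSEQ_def
    proof (intro allI)
      fix k m
      show "(\<lambda>n. schwartz_seminorm k m (?g n - f)) \<longlonglongrightarrow> 0"
      proof (rule tendsto_sandwich[where f = "\<lambda>_. 0" and h = "\<lambda>n. 1 / (real n + 1)"])
        show "\<forall>\<^sub>F n in sequentially. schwartz_seminorm k m (?g n - f) \<le> 1 / (real n + 1)"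
          using eventually_ge_at_top[of "max k m"] by eventually_elim (use close[OF K] in auto)
        show "(\<lambda>n. 1 / (real n + 1)) \<longlonglongrightarrow> 0"
          using LIMSEQ_inverse_real_of_nat by (simp add: inverse_eq_divide add.commute)
      qed (simp_all add: schwartz_seminorm_nonneg)
    qed
    moreover have "range ?g \<subseteq> range (\<lambda>(n, K, d). rep n K d)"
    proof (rule image_subsetI)
      fix n show "?g n \<in> range (\<lambda>(n, K, d). rep n K d)"
        by (rule image_eqI[where x = "(n, K n, code n (K n) f)"]) auto
    qed
    ultimately show "\<exists>g. range g \<subseteq> range (\<lambda>(n, K, d). rep n K d) \<and> schwartz_LIMSEQ g f" by blast
  qed
qed

section \<open>Gaussians as Schwartz functions\<close>

lemma poly_gaussian_has_derivative:
  "((\<lambda>x. poly p x * exp (- ((x - c)\<^sup>2))) has_real_derivative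
    poly (pderiv p - 2 * [:- c, 1:] * p) x * exp (- ((x - c)\<^sup>2))) (at x)"
  by (auto intro!: derivative_eq_intros simp: algebra_simps)

text \<open>Polynomial multiples of a Gaussian are closed under differentiation; decay of all
  derivatives thus reduces to decay of such products.\<close>

lemma higher_deriv_poly_gaussian:
  "\<exists>q. (deriv ^^ m) (\<lambda>x. poly p x * exp (- ((x - c)\<^sup>2))) = (\<lambda>x. poly q x * exp (- ((x - c)\<^sup>2)))" for c :: real
proof (induction m)
  case (Suc m)
  then obtain q where "(deriv ^^ m) (\<lambda>x. poly p x * exp (- ((x - c)\<^sup>2))) = (\<lambda>x. poly q x * exp (- ((x - c)\<^sup>2)))"
    by blast
  then have "(deriv ^^ Suc m) (\<lambda>x. poly p x * exp (- ((x - c)\<^sup>2)))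
      = (\<lambda>x. poly (pderiv q - 2 * [:- c, 1:] * q) x * exp (- ((x - c)\<^sup>2)))"
    by (simp only: funpow.simps o_apply) (rule ext, rule DERIV_imp_deriv[OF poly_gaussian_has_derivative])
  then show ?case by blast
qed auto

text \<open>Comes from \<open>(1 + y / k) ^ k \<le> exp y\<close> at
  \<open>y = \<bar>x\<bar>\<close>; the case \<open>k = 0\<close> is separate because of the
  division.\<close>

lemma power_le_exp_abs: "\<bar>x\<bar> ^ k \<le> real k ^ k * exp \<bar>x\<bar>"
proof (cases "k = 0")
  case False
  have "\<bar>x\<bar> ^ k = real k ^ k * (\<bar>x\<bar> / real k) ^ k" using False by (simp add: power_divide)
  also have "\<dots> \<le> real k ^ k * (1 + \<bar>x\<bar> / real k) ^ k" by (intro mult_left_mono power_mono) auto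
  also have "\<dots> \<le> real k ^ k * exp \<bar>x\<bar>"
    using False by (intro mult_left_mono exp_ge_one_plus_x_over_n_power_n) auto
  finally show ?thesis .
qed simp

lemma bounded_power_gaussian: "bounded (range (\<lambda>x. x ^ k * exp (- ((x - c)\<^sup>2))))" for c :: real
proof -
  have "norm (x ^ k * exp (- ((x - c)\<^sup>2))) \<le> real k ^ k * exp (\<bar>c\<bar> + 1)" for x
  proof -
    \<comment> \<open>The square gives \<open>\<bar>x - c\<bar> \<le> (x - c)\<^sup>2 + 1\<close>,
      so the Gaussian absorbs the factor \<open>exp \<bar>x\<bar>\<close> that dominates the
      power.\<close>
    have "0 \<le> (\<bar>x - c\<bar> - 1)\<^sup>2 + \<bar>x - c\<bar>" by simp
    then have "\<bar>x - c\<bar> \<le> (x - c)\<^sup>2 + 1" by (simp add: power2_diff)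
    then have "\<bar>x\<bar> - (x - c)\<^sup>2 \<le> \<bar>c\<bar> + 1" by linarith
    then have "exp (\<bar>x\<bar> - (x - c)\<^sup>2) \<le> exp (\<bar>c\<bar> + 1)" by simp
    then have "real k ^ k * (exp \<bar>x\<bar> * exp (- ((x - c)\<^sup>2))) \<le> real k ^ k * exp (\<bar>c\<bar> + 1)"
      by (intro mult_left_mono) (auto simp: exp_add[symmetric])
    moreover have "\<bar>x\<bar> ^ k * exp (- ((x - c)\<^sup>2)) \<le> real k ^ k * exp \<bar>x\<bar> * exp (- ((x - c)\<^sup>2))"
      by (intro mult_right_mono power_le_exp_abs) auto
    ultimately have "\<bar>x\<bar> ^ k * exp (- ((x - c)\<^sup>2)) \<le> real k ^ k * exp (\<bar>c\<bar> + 1)" by (simp only: mult.assoc)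
    then show ?thesis by (simp add: abs_mult power_abs)
  qed
  then show ?thesis by (auto simp: bounded_iff)
qed

text \<open>Induction on the coefficients with \<open>k\<close> arbitrary, since peeling off the
  constant coefficient turns \<open>x ^ k\<close> into \<open>x ^ Suc k\<close>.\<close>

lemma bounded_poly_gaussian: "bounded (range (\<lambda>x. x ^ k * (poly p x * exp (- ((x - c)\<^sup>2)))))" for c :: real
proof (induction p arbitrary: k)
  case 0
  then show ?case by simp
next
  case (pCons a p)
  have "bounded (range (\<lambda>x. a *\<^sub>R (x ^ k * exp (- ((x - c)\<^sup>2))) + x ^ Suc k * (poly p x * exp (- ((x - c)\<^sup>2)))))"
    by (intro bounded_plus_comp bounded_scaleR_comp bounded_power_gaussian pCons.IH)
  then show ?case by (simp add: algebra_simps)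
qed

lemma rapidly_decreasing_gaussian: "rapidly_decreasing (\<lambda>x. exp (- ((x - c)\<^sup>2)))"
proof -
  have "\<exists>q. (deriv ^^ m) (\<lambda>x. exp (- ((x - c)\<^sup>2))) = (\<lambda>x. poly q x * exp (- ((x - c)\<^sup>2)))" for m
    using higher_deriv_poly_gaussian[of m 1 c] by simp
  then obtain q where q: "\<And>m. (deriv ^^ m) (\<lambda>x. exp (- ((x - c)\<^sup>2))) = (\<lambda>x. poly (q m) x * exp (- ((x - c)\<^sup>2)))"
    by metis
  show ?thesis
    unfolding rapidly_decreasing_def smooth_def q
    using poly_gaussian_has_derivative by (auto simp: real_differentiable_def intro!: bounded_poly_gaussian)
qed

lemma exists_schwartz_one_at:
  obtains f where "schwartz_fun f c = 1"
proof
  show "schwartz_fun (Schwartz (\<lambda>x. exp (- ((x - c)\<^sup>2)))) c = 1"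
    using Schwartz_inverse[of "\<lambda>x. exp (- ((x - c)\<^sup>2))"] rapidly_decreasing_gaussian by simp
qed

section \<open>Cosines as test functions\<close>

text \<open>Each derivative is a phase shift by a quarter period and a factor \<theta>. One formula
  for all \<open>n\<close> shows smoothness and boundedness together.\<close>

lemma higher_deriv_cos: "(deriv ^^ n) (\<lambda>x. cos (\<theta> * x + \<phi>)) = (\<lambda>x. \<theta> ^ n * cos (\<theta> * x + \<phi> + real n * (pi / 2)))"
proof (induction n)
  case (Suc n)
  have "deriv (\<lambda>x. \<theta> ^ n * cos (\<theta> * x + \<phi> + real n * (pi / 2))) x
      = \<theta> ^ Suc n * cos (\<theta> * x + \<phi> + real (Suc n) * (pi / 2))" for x
  proof (rule DERIV_imp_deriv)
    have "\<theta> * x + \<phi> + real (Suc n) * (pi / 2) = (\<theta> * x + \<phi> + real n * (pi / 2)) + pi / 2"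
      by (simp add: field_simps)
    then have "cos (\<theta> * x + \<phi> + real (Suc n) * (pi / 2)) = - sin (\<theta> * x + \<phi> + real n * (pi / 2))"
      by (simp only: cos_add cos_pi_half sin_pi_half)
    then show "((\<lambda>x. \<theta> ^ n * cos (\<theta> * x + \<phi> + real n * (pi / 2))) has_real_derivative
        \<theta> ^ Suc n * cos (\<theta> * x + \<phi> + real (Suc n) * (pi / 2))) (at x)"
      by (auto intro!: derivative_eq_intros)
  qed
  with Suc show ?case by simp
qed simp

lemma smooth_bounded_cos: "smooth_bounded (\<lambda>x. cos (\<theta> * x + \<phi>))"
  unfolding smooth_bounded_def smooth_def higher_deriv_cos
proof (intro conjI allI)
  show "(\<lambda>x. \<theta> ^ n * cos (\<theta> * x + \<phi> + real n * (pi / 2))) differentiable at x" for n x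
  proof -
    have "((\<lambda>x. \<theta> ^ n * cos (\<theta> * x + \<phi> + real n * (pi / 2))) has_real_derivative
        \<theta> ^ n * (- sin (\<theta> * x + \<phi> + real n * (pi / 2)) * \<theta>)) (at x)"
      by (auto intro!: derivative_eq_intros)
    then show ?thesis unfolding real_differentiable_def by blast
  qed
  show "bounded (range (\<lambda>x. \<theta> ^ n * cos (\<theta> * x + \<phi> + real n * (pi / 2))))" for n
    by (auto simp: bounded_iff abs_mult intro!: exI[of _ "\<bar>\<theta> ^ n\<bar>"] mult_left_le)
qed

section \<open>Martingales and processes of finite variation\<close>

lemma borel_measurable_continuous_process:
  fixes g :: "real \<Rightarrow> 'w \<Rightarrow> real"
  assumes "s \<le> t" and meas: "\<And>r. r \<in> {s..t} \<Longrightarrow> g r \<in> borel_measurable M"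
    and cont: "\<And>\<omega>. \<omega> \<in> space M \<Longrightarrow> continuous_on {s..t} (\<lambda>r. g r \<omega>)"
  shows "(\<lambda>(r, \<omega>). indicator {s..t} r * g r \<omega>) \<in> borel_measurable (lborel \<Otimes>\<^sub>M M)"
proof -
  \<comment> \<open>Clamping keeps the grid point inside the interval on which \<open>g\<close> is
    measurable and continuous; it does not affect the limit for \<open>r\<close> in that
    interval.\<close>
  define p where "p n r = min t (max s (real_of_int \<lfloor>real (Suc n) * r\<rfloor> / real (Suc n)))" for n r
  have p_in: "p n r \<in> {s..t}" for n r using \<open>s \<le> t\<close> by (auto simp: p_def)
  have p_lim: "(\<lambda>n. p n r) \<longlonglongrightarrow> r" if "r \<in> {s..t}" for r
  proof -
    have "(\<lambda>n. real_of_int \<lfloor>real (Suc n) * r\<rfloor> / real (Suc n)) \<longlonglongrightarrow> r"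
    proof (rule tendsto_sandwich)
      show "\<forall>\<^sub>F n in sequentially. r - 1 / real (Suc n) \<le> real_of_int \<lfloor>real (Suc n) * r\<rfloor> / real (Suc n)"
      proof (intro always_eventually allI)
        fix n
        have "real (Suc n) * r - 1 \<le> real_of_int \<lfloor>real (Suc n) * r\<rfloor>" by linarith
        then have "(real (Suc n) * r - 1) / real (Suc n) \<le> real_of_int \<lfloor>real (Suc n) * r\<rfloor> / real (Suc n)"
          by (intro divide_right_mono) auto
        then show "r - 1 / real (Suc n) \<le> real_of_int \<lfloor>real (Suc n) * r\<rfloor> / real (Suc n)"
          by (simp add: diff_divide_distrib del: of_nat_Suc)
      qed
      show "\<forall>\<^sub>F n in sequentially. real_of_int \<lfloor>real (Suc n) * r\<rfloor> / real (Suc n) \<le> r"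
        by (intro always_eventually allI) (simp add: pos_divide_le_eq mult.commute del: of_nat_Suc)
      have "(\<lambda>n. 1 / real (Suc n)) \<longlonglongrightarrow> 0"
        using LIMSEQ_inverse_real_of_nat by (simp add: inverse_eq_divide)
      then show "(\<lambda>n. r - 1 / real (Suc n)) \<longlonglongrightarrow> r"
        using tendsto_diff[OF tendsto_const[of r]] by fastforce
    qed simp
    then have "(\<lambda>n. p n r) \<longlonglongrightarrow> min t (max s r)"
      unfolding p_def by (intro tendsto_min tendsto_max tendsto_const)
    then show ?thesis using that by simp
  qed
  show ?thesis
  proof (rule borel_measurable_LIMSEQ_real)
    fix n
    have "(\<lambda>x. (\<lambda>(k::int) (r, \<omega>). g (min t (max s (real_of_int k / real (Suc n)))) \<omega>) \<lfloor>real (Suc n) * fst x\<rfloor> x)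
        \<in> borel_measurable (lborel \<Otimes>\<^sub>M M)"
    proof (rule measurable_compose_countable[where g = "\<lambda>x. \<lfloor>real (Suc n) * fst x\<rfloor>"])
      fix k :: int
      have "min t (max s (real_of_int k / real (Suc n))) \<in> {s..t}" using \<open>s \<le> t\<close> by auto
      from meas[OF this]
      show "(\<lambda>(r, \<omega>). g (min t (max s (real_of_int k / real (Suc n)))) \<omega>) \<in> borel_measurable (lborel \<Otimes>\<^sub>M M)"
        by measurable
    qed measurable
    then have "(\<lambda>(r, \<omega>). g (p n r) \<omega>) \<in> borel_measurable (lborel \<Otimes>\<^sub>M M)"
      by (simp add: p_def case_prod_beta del: of_nat_Suc)
    then show "(\<lambda>(r, \<omega>). indicator {s..t} r * g (p n r) \<omega>) \<in> borel_measurable (lborel \<Otimes>\<^sub>M M)"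
      by measurable
  next
    fix x :: "real \<times> 'w" assume "x \<in> space (lborel \<Otimes>\<^sub>M M)"
    then obtain r :: real and \<omega> where x: "x = (r, \<omega>)" "\<omega> \<in> space M" by (auto simp: space_pair_measure)
    have "(\<lambda>n. g (p n r) \<omega>) \<longlonglongrightarrow> g r \<omega>" if "r \<in> {s..t}"
      by (rule continuous_on_tendsto_compose[OF cont[OF x(2)] p_lim[OF that] that])
        (use p_in in auto)
    then show "(\<lambda>n. case x of (r, \<omega>) \<Rightarrow> indicator {s..t} r * g (p n r) \<omega>) \<longlonglongrightarrow>
        (case x of (r, \<omega>) \<Rightarrow> indicator {s..t} r * g r \<omega>)"
      by (auto simp: x indicator_def)
  qed
qed

text \<open>\<open>M\<close> is an arbitrary measure space here; taking \<open>F t\<close> for it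
  shows that integrals of adapted continuous processes are adapted.\<close>

lemma borel_measurable_integral_continuous_process:
  fixes g :: "real \<Rightarrow> 'w \<Rightarrow> real"
  assumes "s \<le> t" and "\<And>r. r \<in> {s..t} \<Longrightarrow> g r \<in> borel_measurable M"
    and "\<And>\<omega>. \<omega> \<in> space M \<Longrightarrow> continuous_on {s..t} (\<lambda>r. g r \<omega>)"
  shows "(\<lambda>\<omega>. LBINT r:{s..t}. g r \<omega>) \<in> borel_measurable M"
proof -
  have "(\<lambda>(\<omega>, r). indicator {s..t} r * g r \<omega>) \<in> borel_measurable (M \<Otimes>\<^sub>M lborel)"
    using measurable_compose[OF measurable_pair_swap' borel_measurable_continuous_process[OF assms]]
    by (simp add: case_prod_beta)
  then show ?thesis
    unfolding set_lebesgue_integral_def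
    by (intro sigma_finite_measure.borel_measurable_lebesgue_integral)
      (simp_all add: lborel.sigma_finite_measure_axioms case_prod_beta)
qed

section \<open>Filtrations, and martingales tested against adapted weights\<close>

locale filtered_prob_space = prob_space M for M :: "'w measure" +
  fixes F :: "real \<Rightarrow> 'w measure"
  assumes subalgebra_F: "0 \<le> t \<Longrightarrow> subalgebra M (F t)"
    and F_mono: "\<lbrakk>0 \<le> s; s \<le> t\<rbrakk> \<Longrightarrow> sets (F s) \<subseteq> sets (F t)"
begin

lemma space_F: "0 \<le> t \<Longrightarrow> space (F t) = space M"
  using subalgebra_F by (auto simp: subalgebra_def)

lemma F_measurable_M: "\<lbrakk>0 \<le> t; f \<in> borel_measurable (F t)\<rbrakk> \<Longrightarrow> f \<in> borel_measurable M"
  using measurable_from_subalg[OF subalgebra_F] .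

lemma F_measurable_mono:
  assumes "0 \<le> s" "s \<le> t" "f \<in> borel_measurable (F s)"
  shows "f \<in> borel_measurable (F t)"
proof -
  have "subalgebra (F t) (F s)"
    using assms F_mono[OF assms(1,2)] by (auto simp: subalgebra_def space_F)
  then show ?thesis using assms(3) by (rule measurable_from_subalg)
qed

lemma martingale_measurable: "\<lbrakk>martingale M F N; 0 \<le> t\<rbrakk> \<Longrightarrow> N t \<in> borel_measurable M"
  by (simp add: martingale_def borel_measurable_integrable)

text \<open>The weight \<open>u\<close> may be unbounded: integrability of \<open>u * N t\<close>
  passes to \<open>u\<close> times the conditional expectation, which is \<open>u * N s\<close>
  almost everywhere.\<close>

lemma martingale_integral_mult:
  assumes N: "martingale M F N" and st: "0 \<le> s" "s \<le> t"
    and u: "u \<in> borel_measurable (F s)" and int: "integrable M (\<lambda>\<omega>. u \<omega> * N t \<omega>)"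
  shows "integrable M (\<lambda>\<omega>. u \<omega> * N s \<omega>)"
    and "(\<integral>\<omega>. u \<omega> * N s \<omega> \<partial>M) = (\<integral>\<omega>. u \<omega> * N t \<omega> \<partial>M)"
proof -
  interpret finite_measure_subalgebra M "F s"
    using subalgebra_F[OF st(1)] by unfold_locales
  have "0 \<le> t" using st by simp
  have [measurable]: "N t \<in> borel_measurable M" "N s \<in> borel_measurable M" "u \<in> borel_measurable M"
    using N st \<open>0 \<le> t\<close> u by (auto intro: F_measurable_M martingale_measurable)
  have ae: "AE \<omega> in M. u \<omega> * real_cond_exp M (F s) (N t) \<omega> = u \<omega> * N s \<omega>"
    using N st by (force simp: martingale_def)
  note * = real_cond_exp_intg[OF int u \<open>N t \<in> borel_measurable M\<close>]
  show "integrable M (\<lambda>\<omega>. u \<omega> * N s \<omega>)"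
    by (rule integrable_cong_AE_imp[OF *(1)]) (use ae in auto)
  have "(\<integral>\<omega>. u \<omega> * N s \<omega> \<partial>M) = (\<integral>\<omega>. u \<omega> * real_cond_exp M (F s) (N t) \<omega> \<partial>M)"
    by (rule integral_cong_AE) (use ae in auto)
  then show "(\<integral>\<omega>. u \<omega> * N s \<omega> \<partial>M) = (\<integral>\<omega>. u \<omega> * N t \<omega> \<partial>M)"
    using *(2) by simp
qed

text \<open>The conditional Jensen inequality for the absolute value. As a statement about
  nonnegative integrals it is available before any integrability is known.\<close>

lemma martingale_nn_integral_mult_le:
  assumes N: "martingale M F N" and st: "0 \<le> s" "s \<le> t"
    and u: "u \<in> borel_measurable (F s)"
  shows "(\<integral>\<^sup>+\<omega>. ennreal (\<bar>u \<omega>\<bar> * \<bar>N s \<omega>\<bar>) \<partial>M) \<le> (\<integral>\<^sup>+\<omega>. ennreal (\<bar>u \<omega>\<bar> * \<bar>N t \<omega>\<bar>) \<partial>M)"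
proof -
  interpret finite_measure_subalgebra M "F s"
    using subalgebra_F[OF st(1)] by unfold_locales
  have "0 \<le> t" using st by simp
  have [measurable]: "N t \<in> borel_measurable M"
    using N \<open>0 \<le> t\<close> by (rule martingale_measurable)
  have "(\<integral>\<^sup>+\<omega>. ennreal (\<bar>u \<omega>\<bar> * \<bar>N s \<omega>\<bar>) \<partial>M)
      \<le> (\<integral>\<^sup>+\<omega>. ennreal \<bar>u \<omega>\<bar> * nn_cond_exp M (F s) (\<lambda>\<omega>. ennreal \<bar>N t \<omega>\<bar>) \<omega> \<partial>M)"
  proof (rule nn_integral_mono_AE)
    have "AE \<omega> in M. real_cond_exp M (F s) (N t) \<omega> = N s \<omega>"
      using N st by (auto simp: martingale_def)
    then show "AE \<omega> in M. ennreal (\<bar>u \<omega>\<bar> * \<bar>N s \<omega>\<bar>)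
        \<le> ennreal \<bar>u \<omega>\<bar> * nn_cond_exp M (F s) (\<lambda>\<omega>. ennreal \<bar>N t \<omega>\<bar>) \<omega>"
      using real_cond_exp_abs[OF \<open>N t \<in> borel_measurable M\<close>]
    proof eventually_elim
      case (elim \<omega>)
      then show ?case
        using mult_left_mono[of "ennreal \<bar>N s \<omega>\<bar>" _ "ennreal \<bar>u \<omega>\<bar>"]
        by (simp add: ennreal_mult)
    qed
  qed
  also have "\<dots> = (\<integral>\<^sup>+\<omega>. ennreal \<bar>u \<omega>\<bar> * ennreal \<bar>N t \<omega>\<bar> \<partial>M)"
    by (rule nn_cond_exp_intg) (use u in auto)
  finally show ?thesis by (simp add: ennreal_mult)
qed

text \<open>Only \<open>N t\<close> is integrable, not the supremum of \<open>N\<close> over \<open>[s, t]\<close>; Fubini is justified by first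
  replacing \<open>\<bar>N r\<bar>\<close> by \<open>\<bar>N t\<bar>\<close> under the expectation.\<close>

lemma martingale_integral_finite_variation:
  assumes N: "martingale M F N" and st: "0 \<le> s" "s \<le> t"
    and N_cont: "\<And>\<omega>. \<omega> \<in> space M \<Longrightarrow> continuous_on {s..t} (\<lambda>r. N r \<omega>)"
    and w_meas: "\<And>r. r \<in> {s..t} \<Longrightarrow> w r \<in> borel_measurable (F r)"
    and w_cont: "\<And>\<omega>. \<omega> \<in> space M \<Longrightarrow> continuous_on {s..t} (\<lambda>r. w r \<omega>)"
    and w_bound: "\<And>\<omega>. \<omega> \<in> space M \<Longrightarrow> (LBINT r:{s..t}. \<bar>w r \<omega>\<bar>) \<le> C"
  shows "integrable M (\<lambda>\<omega>. LBINT r:{s..t}. N r \<omega> * w r \<omega>)"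
    and "(\<integral>\<omega>. (LBINT r:{s..t}. N r \<omega> * w r \<omega>) \<partial>M) = (\<integral>\<omega>. N t \<omega> * (LBINT r:{s..t}. w r \<omega>) \<partial>M)"
proof -
  interpret P: pair_sigma_finite lborel M ..
  have t0: "0 \<le> t" using st by simp
  have Nt: "integrable M (N t)" using N t0 by (auto simp: martingale_def)
  have Nr: "N r \<in> borel_measurable M" if "r \<in> {s..t}" for r
    using N that st by (auto intro: martingale_measurable)
  have wr: "w r \<in> borel_measurable M" if "r \<in> {s..t}" for r
    using w_meas[OF that] that st by (auto intro: F_measurable_M[of r])
  have [measurable]: "N t \<in> borel_measurable M" using Nr st by auto
  define H where "H = (\<lambda>(r, \<omega>). indicator {s..t} r * (N r \<omega> * w r \<omega>))"
  define K where "K = (\<lambda>(r, \<omega>). indicator {s..t} r * w r \<omega> * N t \<omega>)"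
  have Hm[measurable]: "H \<in> borel_measurable (lborel \<Otimes>\<^sub>M M)"
    unfolding H_def
    by (rule borel_measurable_continuous_process[OF st(2)])
      (use Nr wr in \<open>auto intro!: continuous_on_mult N_cont w_cont\<close>)
  have Km[measurable]: "K \<in> borel_measurable (lborel \<Otimes>\<^sub>M M)"
    using borel_measurable_continuous_process[OF st(2) wr w_cont] unfolding K_def by measurable
  \<comment> \<open>In \<open>K\<close> the factor \<open>N t\<close> does not depend on time, so
    integrating over time first leaves at most \<open>C\<close> times the expectation of
    \<open>\<bar>N t\<bar>\<close>.\<close>
  have nnK: "(\<integral>\<^sup>+z. ennreal (norm (K z)) \<partial>(lborel \<Otimes>\<^sub>M M)) < \<infinity>"
  proof -
    have "(\<integral>\<^sup>+z. ennreal (norm (K z)) \<partial>(lborel \<Otimes>\<^sub>M M))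
        = (\<integral>\<^sup>+\<omega>. (\<integral>\<^sup>+r. ennreal (norm (K (r, \<omega>))) \<partial>lborel) \<partial>M)"
      by (rule P.nn_integral_snd[symmetric]) measurable
    also have "\<dots> \<le> (\<integral>\<^sup>+\<omega>. ennreal (C * \<bar>N t \<omega>\<bar>) \<partial>M)"
    proof (rule nn_integral_mono)
      fix \<omega> assume \<omega>: "\<omega> \<in> space M"
      have si: "set_integrable lborel {s..t} (\<lambda>r. \<bar>w r \<omega>\<bar>)"
        by (rule borel_integrable_atLeastAtMost') (intro continuous_on_rabs w_cont \<omega>)
      have nn: "(\<integral>\<^sup>+r. ennreal (indicator {s..t} r * \<bar>w r \<omega>\<bar>) \<partial>lborel) = ennreal (LBINT r:{s..t}. \<bar>w r \<omega>\<bar>)"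
        using nn_integral_eq_integral[of lborel "\<lambda>r. indicator {s..t} r * \<bar>w r \<omega>\<bar>"] si
        by (simp add: set_integrable_def set_lebesgue_integral_def)
      have m: "(\<lambda>r. ennreal (indicator {s..t} r * \<bar>w r \<omega>\<bar>)) \<in> borel_measurable lborel"
        using si by (intro measurable_compose[OF _ measurable_ennreal])
          (simp add: set_integrable_def borel_measurable_integrable)
      have "(\<integral>\<^sup>+r. ennreal (norm (K (r, \<omega>))) \<partial>lborel)
          = ennreal (LBINT r:{s..t}. \<bar>w r \<omega>\<bar>) * ennreal \<bar>N t \<omega>\<bar>"
        unfolding nn[symmetric] nn_integral_multc[OF m, symmetric]
        by (intro nn_integral_cong) (simp add: K_def abs_mult ennreal_mult')
      also have "\<dots> \<le> ennreal C * ennreal \<bar>N t \<omega>\<bar>"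
        using w_bound[OF \<omega>] by (intro mult_right_mono ennreal_leI) auto
      finally show "(\<integral>\<^sup>+r. ennreal (norm (K (r, \<omega>))) \<partial>lborel) \<le> ennreal (C * \<bar>N t \<omega>\<bar>)"
        by (simp add: ennreal_mult'')
    qed
    also have "\<dots> < \<infinity>"
      using Nt by (simp add: ennreal_mult'' nn_integral_cmult ennreal_mult_less_top integrable_iff_bounded)
    finally show ?thesis .
  qed
  have Kint: "integrable (lborel \<Otimes>\<^sub>M M) K"
    using nnK by (intro integrableI_bounded) auto
  have "(\<integral>\<^sup>+z. ennreal (norm (H z)) \<partial>(lborel \<Otimes>\<^sub>M M))
      = (\<integral>\<^sup>+r. (\<integral>\<^sup>+\<omega>. ennreal (norm (H (r, \<omega>))) \<partial>M) \<partial>lborel)"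
    by (rule nn_integral_fst[symmetric]) measurable
  also have "\<dots> \<le> (\<integral>\<^sup>+r. (\<integral>\<^sup>+\<omega>. ennreal (norm (K (r, \<omega>))) \<partial>M) \<partial>lborel)"
  proof (rule nn_integral_mono)
    fix r :: real
    show "(\<integral>\<^sup>+\<omega>. ennreal (norm (H (r, \<omega>))) \<partial>M) \<le> (\<integral>\<^sup>+\<omega>. ennreal (norm (K (r, \<omega>))) \<partial>M)"
    proof (cases "r \<in> {s..t}")
      case True
      then show ?thesis
        using martingale_nn_integral_mult_le[OF N _ _ w_meas[OF True], of t] st
        by (simp add: H_def K_def abs_mult mult.commute)
    qed (auto simp: H_def)
  qed
  also have "\<dots> = (\<integral>\<^sup>+z. ennreal (norm (K z)) \<partial>(lborel \<Otimes>\<^sub>M M))"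
    by (rule nn_integral_fst) measurable
  finally have Hint: "integrable (lborel \<Otimes>\<^sub>M M) H"
    using nnK by (intro integrableI_bounded) auto
  have "integrable M (\<lambda>\<omega>. \<integral>r. H (r, \<omega>) \<partial>lborel)"
    using P.integrable_snd[of "\<lambda>r \<omega>. H (r, \<omega>)"] Hint by simp
  then show "integrable M (\<lambda>\<omega>. LBINT r:{s..t}. N r \<omega> * w r \<omega>)"
    by (simp add: H_def set_lebesgue_integral_def)
  have "(\<integral>\<omega>. (LBINT r:{s..t}. N r \<omega> * w r \<omega>) \<partial>M) = (\<integral>\<omega>. (\<integral>r. H (r, \<omega>) \<partial>lborel) \<partial>M)"
    by (simp add: H_def set_lebesgue_integral_def)
  also have "\<dots> = (\<integral>r. (\<integral>\<omega>. H (r, \<omega>) \<partial>M) \<partial>lborel)"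
    using P.Fubini_integral[of "\<lambda>r \<omega>. H (r, \<omega>)"] Hint by simp
  also have "\<dots> = (\<integral>r. (\<integral>\<omega>. K (r, \<omega>) \<partial>M) \<partial>lborel)"
  proof (rule integral_cong_AE)
    \<comment> \<open>By Fubini the sections of \<open>K\<close> are integrable for almost every
      \<open>r\<close>; this is the integrability that the martingale identity at time
      \<open>r\<close> asks for.\<close>
    show "AE r in lborel. (\<integral>\<omega>. H (r, \<omega>) \<partial>M) = (\<integral>\<omega>. K (r, \<omega>) \<partial>M)"
      using P.AE_integrable_fst'[OF Kint]
    proof eventually_elim
      case (elim r)
      show ?case
      proof (cases "r \<in> {s..t}")
        case True
        then have "integrable M (\<lambda>\<omega>. w r \<omega> * N t \<omega>)" using elim by (simp add: K_def)
        then show ?thesis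
          using martingale_integral_mult(2)[OF N _ _ w_meas[OF True], of t] True st
          by (simp add: H_def K_def mult.commute)
      qed (simp add: H_def K_def)
    qed
  qed measurable
  also have "\<dots> = (\<integral>\<omega>. (\<integral>r. K (r, \<omega>) \<partial>lborel) \<partial>M)"
    using P.Fubini_integral[of "\<lambda>r \<omega>. K (r, \<omega>)"] Kint by simp
  also have "\<dots> = (\<integral>\<omega>. N t \<omega> * (LBINT r:{s..t}. w r \<omega>) \<partial>M)"
    by (simp add: K_def set_lebesgue_integral_def mult.commute)
  finally show "(\<integral>\<omega>. (LBINT r:{s..t}. N r \<omega> * w r \<omega>) \<partial>M) = (\<integral>\<omega>. N t \<omega> * (LBINT r:{s..t}. w r \<omega>) \<partial>M)" .
qed

end

section \<open>Calculus along a path\<close>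

lemma LBINT_continuous:
  fixes f :: "real \<Rightarrow> real"
  assumes "continuous_on {a..b} f"
  shows "(LBINT x:{a..b}. f x) = integral {a..b} f"
  using borel_integrable_atLeastAtMost'[OF assms] by (rule set_borel_integral_eq_integral(2))

lemma LBINT_deriv:
  fixes h :: "real \<Rightarrow> real"
  assumes "s \<le> t" and "continuous_on {s..t} h'"
    and "\<And>r. r \<in> {s..t} \<Longrightarrow> (h has_real_derivative h' r) (at r within {s..t})"
  shows "(LBINT r:{s..t}. h' r) = h t - h s"
  using fundamental_theorem_of_calculus[OF assms(1), of h h'] assms
  by (simp add: LBINT_continuous has_real_derivative_iff_has_vector_derivative integral_unique)

text \<open>An integral is estimated through an explicit primitive of a majorant. In the
  applications the primitive is built from the damping factor, whose derivative reproduces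
  \<open>\<bar>a r\<bar>\<close> times that factor.\<close>

lemma LBINT_le_deriv:
  fixes h :: "real \<Rightarrow> real"
  assumes "s \<le> t" "continuous_on {s..t} f" "continuous_on {s..t} h'"
    and "\<And>r. r \<in> {s..t} \<Longrightarrow> f r \<le> h' r"
    and "\<And>r. r \<in> {s..t} \<Longrightarrow> (h has_real_derivative h' r) (at r within {s..t})"
  shows "(LBINT r:{s..t}. f r) \<le> h t - h s"
proof -
  have "(LBINT r:{s..t}. f r) \<le> (LBINT r:{s..t}. h' r)"
    by (intro set_integral_mono borel_integrable_atLeastAtMost') (use assms in auto)
  then show ?thesis using LBINT_deriv[OF assms(1,3,5)] by simp
qed

lemma abs_LBINT_le_deriv:
  fixes h :: "real \<Rightarrow> real"
  assumes "s \<le> t" "continuous_on {s..t} f" "continuous_on {s..t} h'"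
    and "\<And>r. r \<in> {s..t} \<Longrightarrow> \<bar>f r\<bar> \<le> h' r"
    and "\<And>r. r \<in> {s..t} \<Longrightarrow> (h has_real_derivative h' r) (at r within {s..t})"
  shows "\<bar>LBINT r:{s..t}. f r\<bar> \<le> h t - h s"
proof -
  have *: "f r \<le> h' r" "- f r \<le> h' r" if "r \<in> {s..t}" for r
    using assms(4)[OF that] by auto
  have "(LBINT r:{s..t}. f r) \<le> h t - h s"
    by (intro LBINT_le_deriv[where h' = h']) (use assms * in auto)
  moreover have "(LBINT r:{s..t}. - f r) \<le> h t - h s"
    by (intro LBINT_le_deriv[where h' = h']) (use assms * in \<open>auto intro!: continuous_on_minus\<close>)
  ultimately show ?thesis by (simp add: set_integral_uminus[OF borel_integrable_atLeastAtMost'[OF assms(2)]])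
qed

lemma LBINT_has_derivative:
  fixes f :: "real \<Rightarrow> real"
  assumes "continuous_on {a..b} f" "x \<in> {a..b}"
  shows "((\<lambda>u. LBINT r:{a..u}. f r) has_real_derivative f x) (at x within {a..b})"
proof -
  have "((\<lambda>u. integral {a..u} f) has_real_derivative f x) (at x within {a..b})"
    using integral_has_vector_derivative[OF assms] by (simp add: has_real_derivative_iff_has_vector_derivative)
  then show ?thesis
  proof (rule has_field_derivative_transform_within[where d = 1])
    fix u assume "u \<in> {a..b}"
    then have "continuous_on {a..u} f" by (intro continuous_on_subset[OF assms(1)]) auto
    then show "integral {a..u} f = (LBINT r:{a..u}. f r)" by (simp add: LBINT_continuous)
  qed (use assms in auto)
qed

section \<open>Integration by parts against a martingale\<close>

context filtered_prob_space
begin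

text \<open>Let \<open>N\<close> be the given martingale. Then \<open>V\<close> is \<open>z\<close>
  times the integral of \<open>W\<close> against \<open>N\<close>, which for \<open>W\<close> of
  finite variation means the increment of \<open>W * N\<close> minus the integral of
  \<open>N * w\<close>. In expectation the latter becomes \<open>N t * (W t - W s)\<close>, leaving
  \<open>W s * (N t - N s)\<close>, whose expectation against \<open>z\<close> vanishes.\<close>

lemma martingale_integration_by_parts:
  assumes N: "martingale M F (\<lambda>t \<omega>. U t \<omega> - c - (LBINT r:{0..t}. q r \<omega>))"
    and st: "0 \<le> s" "s \<le> t"
    and U_cont: "\<And>\<omega>. \<omega> \<in> space M \<Longrightarrow> continuous_on {0..} (\<lambda>r. U r \<omega>)"
    and q_cont: "\<And>\<omega>. \<omega> \<in> space M \<Longrightarrow> continuous_on {0..} (\<lambda>r. q r \<omega>)"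
    and W_meas: "\<And>r. 0 \<le> r \<Longrightarrow> W r \<in> borel_measurable (F r)"
    and W_bound: "\<And>r \<omega>. \<lbrakk>r \<in> {s..t}; \<omega> \<in> space M\<rbrakk> \<Longrightarrow> \<bar>W r \<omega>\<bar> \<le> K"
    and w_meas: "\<And>r. 0 \<le> r \<Longrightarrow> w r \<in> borel_measurable (F r)"
    and w_cont: "\<And>\<omega>. \<omega> \<in> space M \<Longrightarrow> continuous_on {s..t} (\<lambda>r. w r \<omega>)"
    and w_bound: "\<And>\<omega>. \<omega> \<in> space M \<Longrightarrow> (LBINT r:{s..t}. \<bar>w r \<omega>\<bar>) \<le> C"
    and W_deriv: "\<And>r \<omega>. \<lbrakk>r \<in> {s..t}; \<omega> \<in> space M\<rbrakk> \<Longrightarrow>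
      ((\<lambda>r. W r \<omega>) has_real_derivative w r \<omega>) (at r within {s..t})"
    and z_meas: "z \<in> borel_measurable (F s)"
    and z_bound: "\<And>\<omega>. \<omega> \<in> space M \<Longrightarrow> \<bar>z \<omega>\<bar> \<le> L"
  defines "V \<equiv> \<lambda>\<omega>. z \<omega> * (W t \<omega> * U t \<omega> - W s \<omega> * U s \<omega>
    - (LBINT r:{s..t}. U r \<omega> * w r \<omega> + q r \<omega> * W r \<omega>))"
  shows "integrable M V" and "(\<integral>\<omega>. V \<omega> \<partial>M) = 0"
proof -
  define Q where "Q r \<omega> = (LBINT r:{0..r}. q r \<omega>)" for r \<omega>
  define N where "N r \<omega> = U r \<omega> - c - Q r \<omega>" for r \<omega>
  have mart: "martingale M F N" using N unfolding N_def Q_def .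
  have t0: "0 \<le> t" using st by simp
  have sub: "{s..t} \<subseteq> {0..}" "{s..t} \<subseteq> {0..t}" "{0..t} \<subseteq> {0..}" using st by auto
  have Q_deriv: "((\<lambda>r. Q r \<omega>) has_real_derivative q r \<omega>) (at r within {s..t})"
    if "r \<in> {s..t}" "\<omega> \<in> space M" for r \<omega>
    unfolding Q_def
    by (rule DERIV_subset[OF LBINT_has_derivative[where b = t]])
      (use that sub continuous_on_subset[OF q_cont] in auto)
  have Q_cont: "continuous_on {s..t} (\<lambda>r. Q r \<omega>)" if "\<omega> \<in> space M" for \<omega>
    using Q_deriv[OF _ that] by (rule DERIV_continuous_on)
  have W_cont: "continuous_on {s..t} (\<lambda>r. W r \<omega>)" if "\<omega> \<in> space M" for \<omega>
    using W_deriv[OF _ that] by (rule DERIV_continuous_on)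
  have N_cont: "continuous_on {s..t} (\<lambda>r. N r \<omega>)" if "\<omega> \<in> space M" for \<omega>
    unfolding N_def using that sub
    by (intro continuous_intros Q_cont continuous_on_subset[OF U_cont]) auto
  have zw_meas: "(\<lambda>\<omega>. z \<omega> * w r \<omega>) \<in> borel_measurable (F r)" if "r \<in> {s..t}" for r
    using that st by (intro borel_measurable_times F_measurable_mono[OF _ _ z_meas] w_meas) auto
  have zw_cont: "continuous_on {s..t} (\<lambda>r. z \<omega> * w r \<omega>)" if "\<omega> \<in> space M" for \<omega>
    using that by (intro continuous_intros w_cont)
  have zw_bound: "(LBINT r:{s..t}. \<bar>z \<omega> * w r \<omega>\<bar>) \<le> L * C" if "\<omega> \<in> space M" for \<omega>
  proof -
    have "0 \<le> (LBINT r:{s..t}. \<bar>w r \<omega>\<bar>)"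
      unfolding set_lebesgue_integral_def by (rule Bochner_Integration.integral_nonneg) auto
    then show ?thesis
      using w_bound[OF that] z_bound[OF that]
      by (simp add: abs_mult) (meson abs_ge_zero mult_mono' )
  qed
  note fv = martingale_integral_finite_variation[OF mart st N_cont zw_meas zw_cont zw_bound]
  have meas[measurable]: "z \<in> borel_measurable M" "W t \<in> borel_measurable M"
    "W s \<in> borel_measurable M" "N t \<in> borel_measurable M" "N s \<in> borel_measurable M"
    using st t0 z_meas W_meas mart
    by (auto intro: F_measurable_M[of s] F_measurable_M[of t] martingale_measurable)
  have NI: "integrable M (N t)" "integrable M (N s)"
    using mart st t0 by (auto simp: martingale_def)
  \<comment> \<open>The two times vary independently because the mixed product of \<open>W s\<close>
    and \<open>N t\<close> occurs as well.\<close>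
  have bdd: "integrable M (\<lambda>\<omega>. (z \<omega> * W r \<omega>) * N r' \<omega>)" if "r \<in> {s,t}" "r' \<in> {s,t}" for r r'
  proof (rule Bochner_Integration.integrable_bound[where f = "\<lambda>\<omega>. (L * K) * N r' \<omega>"])
    show "integrable M (\<lambda>\<omega>. (L * K) * N r' \<omega>)" using NI that by auto
    show "(\<lambda>\<omega>. z \<omega> * W r \<omega> * N r' \<omega>) \<in> borel_measurable M" using that by auto
    show "AE \<omega> in M. norm (z \<omega> * W r \<omega> * N r' \<omega>) \<le> norm (L * K * N r' \<omega>)"
    proof (rule AE_I2)
      fix \<omega> assume \<omega>: "\<omega> \<in> space M"
      have r: "r \<in> {s..t}" using that st by auto
      have "\<bar>z \<omega>\<bar> * \<bar>W r \<omega>\<bar> \<le> L * K"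
        using z_bound[OF \<omega>] W_bound[OF r \<omega>] by (meson abs_ge_zero mult_mono' )
      then have "\<bar>z \<omega>\<bar> * \<bar>W r \<omega>\<bar> \<le> \<bar>L * K\<bar>" by linarith
      then show "norm (z \<omega> * W r \<omega> * N r' \<omega>) \<le> norm (L * K * N r' \<omega>)"
        by (simp add: abs_mult mult_right_mono)
    qed
  qed
  have V: "V \<omega> = (z \<omega> * W t \<omega>) * N t \<omega> - (z \<omega> * W s \<omega>) * N s \<omega> - (LBINT r:{s..t}. N r \<omega> * (z \<omega> * w r \<omega>))"
    if \<omega>: "\<omega> \<in> space M" for \<omega>
  proof -
    note c = W_cont[OF \<omega>] w_cont[OF \<omega>] Q_cont[OF \<omega>] continuous_on_subset[OF q_cont[OF \<omega>] sub(1)]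
      continuous_on_subset[OF U_cont[OF \<omega>] sub(1)]
    define i where "i = (LBINT r:{s..t}. N r \<omega> * w r \<omega>)"
    have "(LBINT r:{s..t}. U r \<omega> * w r \<omega> + q r \<omega> * W r \<omega>)
        = (LBINT r:{s..t}. N r \<omega> * w r \<omega> + (c * w r \<omega> + (Q r \<omega> * w r \<omega> + q r \<omega> * W r \<omega>)))"
      by (simp add: N_def algebra_simps)
    also have "\<dots> = i + (LBINT r:{s..t}. c * w r \<omega> + (Q r \<omega> * w r \<omega> + q r \<omega> * W r \<omega>))"
      unfolding i_def
      by (intro set_integral_add borel_integrable_atLeastAtMost' continuous_intros c N_cont \<omega>)
    \<comment> \<open>This integrand is the derivative of \<open>(c + Q) * W\<close>, so the part of
      \<open>U\<close> outside the martingale integrates in closed form.\<close>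
    also have "(LBINT r:{s..t}. c * w r \<omega> + (Q r \<omega> * w r \<omega> + q r \<omega> * W r \<omega>))
        = (c * W t \<omega> + Q t \<omega> * W t \<omega>) - (c * W s \<omega> + Q s \<omega> * W s \<omega>)"
      by (rule LBINT_deriv[OF st(2)])
        (use c \<omega> in \<open>auto intro!: continuous_intros derivative_eq_intros W_deriv Q_deriv\<close>)
    finally have *: "(LBINT r:{s..t}. U r \<omega> * w r \<omega> + q r \<omega> * W r \<omega>)
        = i + ((c * W t \<omega> + Q t \<omega> * W t \<omega>) - (c * W s \<omega> + Q s \<omega> * W s \<omega>))" .
    have "(LBINT r:{s..t}. N r \<omega> * (z \<omega> * w r \<omega>)) = z \<omega> * i"
      by (simp add: i_def mult.left_commute)
    then show ?thesis
      unfolding V_def * by (simp add: N_def algebra_simps)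
  qed
  let ?V = "\<lambda>\<omega>. (z \<omega> * W t \<omega>) * N t \<omega> - (z \<omega> * W s \<omega>) * N s \<omega> - (LBINT r:{s..t}. N r \<omega> * (z \<omega> * w r \<omega>))"
  have "integrable M ?V"
    by (intro Bochner_Integration.integrable_diff bdd fv) auto
  then show "integrable M V"
    by (subst Bochner_Integration.integrable_cong[OF refl V]) auto
  have "(\<integral>\<omega>. (LBINT r:{s..t}. N r \<omega> * (z \<omega> * w r \<omega>)) \<partial>M)
      = (\<integral>\<omega>. N t \<omega> * (LBINT r:{s..t}. z \<omega> * w r \<omega>) \<partial>M)"
    by (rule fv(2))
  also have "\<dots> = (\<integral>\<omega>. (z \<omega> * W t \<omega>) * N t \<omega> - (z \<omega> * W s \<omega>) * N t \<omega> \<partial>M)"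
  proof (rule Bochner_Integration.integral_cong[OF refl])
    fix \<omega> assume "\<omega> \<in> space M"
    then have "(LBINT r:{s..t}. w r \<omega>) = W t \<omega> - W s \<omega>"
      by (intro LBINT_deriv st w_cont W_deriv)
    then have *: "(LBINT r:{s..t}. z \<omega> * w r \<omega>) = z \<omega> * (W t \<omega> - W s \<omega>)" by simp
    show "N t \<omega> * (LBINT r:{s..t}. z \<omega> * w r \<omega>) = (z \<omega> * W t \<omega>) * N t \<omega> - (z \<omega> * W s \<omega>) * N t \<omega>"
      unfolding * by (simp add: algebra_simps)
  qed
  also have "\<dots> = (\<integral>\<omega>. (z \<omega> * W t \<omega>) * N t \<omega> \<partial>M) - (\<integral>\<omega>. (z \<omega> * W s \<omega>) * N t \<omega> \<partial>M)"
    by (intro Bochner_Integration.integral_diff bdd) auto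
  also have "(\<integral>\<omega>. (z \<omega> * W s \<omega>) * N t \<omega> \<partial>M) = (\<integral>\<omega>. (z \<omega> * W s \<omega>) * N s \<omega> \<partial>M)"
    by (rule martingale_integral_mult(2)[OF mart st, symmetric])
      (use bdd z_meas W_meas st in auto)
  finally have "(\<integral>\<omega>. ?V \<omega> \<partial>M) = 0"
    using bdd[of t t] bdd[of s s] fv(1) by simp
  then show "(\<integral>\<omega>. V \<omega> \<partial>M) = 0"
    by (subst Bochner_Integration.integral_cong[OF refl V]) auto
qed

end

section \<open>Exponential martingales without localisation\<close>

text \<open>The integrand in \<open>problem\<close> is \<open>G' * a + v / 2 * G''\<close> for the
  cosine \<open>G\<close>. A free phase \<phi> makes cosines and sines available at once.\<close>

locale trigonometric_martingale_problem = filtered_prob_space +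
  fixes X a :: "real \<Rightarrow> 'a \<Rightarrow> real" and x0 v :: real
  assumes X_meas: "0 \<le> r \<Longrightarrow> X r \<in> borel_measurable (F r)"
    and a_meas: "0 \<le> r \<Longrightarrow> a r \<in> borel_measurable (F r)"
    and X_cont: "\<omega> \<in> space M \<Longrightarrow> continuous_on {0..} (\<lambda>r. X r \<omega>)"
    and a_cont: "\<omega> \<in> space M \<Longrightarrow> continuous_on {0..} (\<lambda>r. a r \<omega>)"
    and problem: "martingale M F (\<lambda>t \<omega>. cos (\<theta> * X t \<omega> + \<phi>) - cos (\<theta> * x0 + \<phi>) -
      (LBINT r:{0..t}. - \<theta> * sin (\<theta> * X r \<omega> + \<phi>) * a r \<omega>
        - \<theta>\<^sup>2 * v / 2 * cos (\<theta> * X r \<omega> + \<phi>)))"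
begin

definition R :: "real \<Rightarrow> 'a \<Rightarrow> real" where
  "R t \<omega> = X t \<omega> - (LBINT r:{0..t}. a r \<omega>)"

lemma a_int_meas: "0 \<le> t \<Longrightarrow> (\<lambda>\<omega>. LBINT r:{0..t}. a r \<omega>) \<in> borel_measurable (F t)"
  by (rule borel_measurable_integral_continuous_process)
    (auto intro: F_measurable_mono a_meas continuous_on_subset[OF a_cont] simp: space_F)

lemma abs_a_int_meas: "0 \<le> t \<Longrightarrow> (\<lambda>\<omega>. LBINT r:{0..t}. \<bar>a r \<omega>\<bar>) \<in> borel_measurable (F t)"
  by (rule borel_measurable_integral_continuous_process)
    (auto intro: F_measurable_mono borel_measurable_abs a_meas
      intro!: continuous_on_rabs continuous_on_subset[OF a_cont] simp: space_F)

lemma R_meas: "0 \<le> t \<Longrightarrow> R t \<in> borel_measurable (F t)"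
  unfolding R_def using X_meas a_int_meas by (intro borel_measurable_diff)

lemma R_cont:
  assumes "\<omega> \<in> space M"
  shows "continuous_on {0..} (\<lambda>t. R t \<omega>)"
proof -
  have "continuous (at t within {0..}) (\<lambda>u. LBINT r:{0..u}. a r \<omega>)" if "t \<in> {0..}" for t
  proof -
    have "((\<lambda>u. LBINT r:{0..u}. a r \<omega>) has_real_derivative a t \<omega>) (at t within {0..t + 1})"
      by (rule LBINT_has_derivative)
        (use that in \<open>auto intro: continuous_on_subset[OF a_cont[OF assms]]\<close>)
    \<comment> \<open>The derivative is known on bounded intervals only; ending the interval beyond
      \<open>t\<close> makes it agree with the half-line near \<open>t\<close>.\<close>
    moreover have "at t within {0..t + 1} = at t within {0..}"
      by (rule at_within_nhd[where S = "{..<t + 1}"]) auto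
    ultimately show ?thesis by (metis DERIV_continuous)
  qed
  then show ?thesis
    unfolding R_def
    by (intro continuous_on_diff X_cont assms) (simp add: continuous_on_eq_continuous_within)
qed

text \<open>The damping factor \<open>D\<close> makes \<open>\<integral>\<bar>a r\<bar> * D r dr\<close> bounded by \<open>1/\<epsilon>\<close>, which takes the place of a
  localising sequence of stopping times.\<close>

lemma damped_expectation:
  fixes \<theta> \<phi> \<epsilon> :: real
  assumes st: "0 \<le> s" "s \<le> t" and \<epsilon>: "0 < \<epsilon>" and v: "0 \<le> v"
    and z_meas: "z \<in> borel_measurable (F s)"
    and z_bound: "\<And>\<omega>. \<omega> \<in> space M \<Longrightarrow> \<bar>z \<omega>\<bar> \<le> L"
  defines "\<kappa> \<equiv> \<theta>\<^sup>2 * v / 2"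
  defines "D \<equiv> \<lambda>r \<omega>. exp (- \<epsilon> * (LBINT u:{0..r}. \<bar>a u \<omega>\<bar>))"
  defines "E \<equiv> \<lambda>r \<omega>. exp (\<kappa> * r) * cos (\<theta> * R r \<omega> + \<phi>)"
  defines "T \<equiv> \<lambda>\<omega>. z \<omega> * (D t \<omega> * E t \<omega> - D s \<omega> * E s \<omega>
    + (LBINT r:{s..t}. \<epsilon> * \<bar>a r \<omega>\<bar> * D r \<omega> * E r \<omega>))"
  shows "integrable M T" and "(\<integral>\<omega>. T \<omega> \<partial>M) = 0"
proof -
  define I where "I r \<omega> = (LBINT u:{0..r}. a u \<omega>)" for r \<omega>
  define J where "J r \<omega> = (LBINT u:{0..r}. \<bar>a u \<omega>\<bar>)" for r \<omega>
  have D: "D = (\<lambda>r \<omega>. exp (- \<epsilon> * J r \<omega>))" by (simp add: D_def J_def)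
  have R: "R r \<omega> = X r \<omega> - I r \<omega>" for r \<omega> by (simp add: R_def I_def)
  have \<kappa>0: "0 \<le> \<kappa>" using v by (simp add: \<kappa>_def)
  have sub: "{s..t} \<subseteq> {0..}" "{s..t} \<subseteq> {0..t}" "{0..t} \<subseteq> {0..}" using st by auto
  have I_deriv: "((\<lambda>r. I r \<omega>) has_real_derivative a r \<omega>) (at r within {s..t})"
    if "r \<in> {s..t}" "\<omega> \<in> space M" for r \<omega>
    unfolding I_def
    by (rule DERIV_subset[OF LBINT_has_derivative[where b = t]])
      (use that sub continuous_on_subset[OF a_cont] in auto)
  have J_deriv: "((\<lambda>r. J r \<omega>) has_real_derivative \<bar>a r \<omega>\<bar>) (at r within {s..t})"
    if "r \<in> {s..t}" "\<omega> \<in> space M" for r \<omega>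
    unfolding J_def
    by (rule DERIV_subset[OF LBINT_has_derivative[where b = t]])
      (use that sub in \<open>auto intro!: continuous_on_rabs intro: continuous_on_subset[OF a_cont]\<close>)
  have J_nonneg: "0 \<le> J r \<omega>" for r \<omega>
    unfolding J_def set_lebesgue_integral_def by (rule Bochner_Integration.integral_nonneg) auto
  have I_meas: "I r \<in> borel_measurable (F r)" if "0 \<le> r" for r
    using a_int_meas[OF that] by (simp add: I_def[abs_def])
  have J_meas: "J r \<in> borel_measurable (F r)" if "0 \<le> r" for r
    using abs_a_int_meas[OF that] by (simp add: J_def[abs_def])
  have [measurable]: "D r \<in> borel_measurable (F r)" if "0 \<le> r" for r
    using J_meas[OF that] unfolding D by measurable
  have D_le1: "D r \<omega> \<le> 1" "0 \<le> D r \<omega>" for r \<omega>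
    using J_nonneg[of r \<omega>] \<epsilon> by (simp_all add: D)
  have a_cont': "continuous_on {s..t} (\<lambda>r. a r \<omega>)" if "\<omega> \<in> space M" for \<omega>
    by (rule continuous_on_subset[OF a_cont[OF that] sub(1)])
  have X_cont': "continuous_on {s..t} (\<lambda>r. X r \<omega>)" if "\<omega> \<in> space M" for \<omega>
    by (rule continuous_on_subset[OF X_cont[OF that] sub(1)])
  have I_cont: "continuous_on {s..t} (\<lambda>r. I r \<omega>)" if "\<omega> \<in> space M" for \<omega>
    using I_deriv[OF _ that] by (rule DERIV_continuous_on)
  have J_cont: "continuous_on {s..t} (\<lambda>r. J r \<omega>)" if "\<omega> \<in> space M" for \<omega>
    using J_deriv[OF _ that] by (rule DERIV_continuous_on)
  \<comment> \<open>\<open>U\<close> solves the martingale problem with compensator density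
    \<open>q\<close>, and \<open>W\<close> is the multiplier with time derivative \<open>w\<close>.
    Their phases are independent because the cosine of a difference needs both a cosine product and
    a sine product.\<close>
  define U where "U \<psi> r \<omega> = cos (\<theta> * X r \<omega> + \<psi>)" for \<psi> r \<omega>
  define q where "q \<psi> r \<omega> = - \<theta> * sin (\<theta> * X r \<omega> + \<psi>) * a r \<omega> - \<theta>\<^sup>2 * v / 2 * cos (\<theta> * X r \<omega> + \<psi>)" for \<psi> r \<omega>
  define W where "W \<psi> r \<omega> = D r \<omega> * exp (\<kappa> * r) * cos (\<theta> * I r \<omega> + \<psi>)" for \<psi> r \<omega>
  define w where "w \<psi> r \<omega> = D r \<omega> * exp (\<kappa> * r) *
    ((\<kappa> - \<epsilon> * \<bar>a r \<omega>\<bar>) * cos (\<theta> * I r \<omega> + \<psi>) - \<theta> * a r \<omega> * sin (\<theta> * I r \<omega> + \<psi>))" for \<psi> r \<omega>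
  define V where "V \<psi> \<psi>' \<omega> = z \<omega> * (W \<psi>' t \<omega> * U \<psi> t \<omega> - W \<psi>' s \<omega> * U \<psi> s \<omega>
    - (LBINT r:{s..t}. U \<psi> r \<omega> * w \<psi>' r \<omega> + q \<psi> r \<omega> * W \<psi>' r \<omega>))" for \<psi> \<psi>' \<omega>
  have V: "integrable M (V \<psi> \<psi>')" "(\<integral>\<omega>. V \<psi> \<psi>' \<omega> \<partial>M) = 0" for \<psi> \<psi>'
    unfolding V_def
  proof (atomize(full), intro conjI)
    have mart: "martingale M F (\<lambda>t \<omega>. U \<psi> t \<omega> - cos (\<theta> * x0 + \<psi>) - (LBINT r:{0..t}. q \<psi> r \<omega>))"
      unfolding U_def q_def by (rule problem)
    have 1: "continuous_on {0..} (\<lambda>r. U \<psi> r \<omega>)" if "\<omega> \<in> space M" for \<omega>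
      unfolding U_def by (intro continuous_intros X_cont that)
    have 2: "continuous_on {0..} (\<lambda>r. q \<psi> r \<omega>)" if "\<omega> \<in> space M" for \<omega>
      unfolding q_def by (intro continuous_intros X_cont a_cont that)
    have 3: "W \<psi>' r \<in> borel_measurable (F r)" if "0 \<le> r" for r
      using I_meas[OF that] that unfolding W_def by measurable
    have 4: "\<bar>W \<psi>' r \<omega>\<bar> \<le> exp (\<kappa> * t)" if "r \<in> {s..t}" "\<omega> \<in> space M" for r \<omega>
    proof -
      have "exp (\<kappa> * r) \<le> exp (\<kappa> * t)" using that \<kappa>0 by (simp add: mult_left_mono)
      then have "D r \<omega> * exp (\<kappa> * r) * \<bar>cos (\<theta> * I r \<omega> + \<psi>')\<bar> \<le> 1 * exp (\<kappa> * t) * 1"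
        by (intro mult_mono) (use D_le1 in auto)
      then show ?thesis using D_le1 by (simp add: W_def abs_mult)
    qed
    have 5: "w \<psi>' r \<in> borel_measurable (F r)" if "0 \<le> r" for r
      using I_meas[OF that] a_meas[OF that] that unfolding w_def by measurable
    have 6: "continuous_on {s..t} (\<lambda>r. w \<psi>' r \<omega>)" if "\<omega> \<in> space M" for \<omega>
      unfolding w_def D by (intro continuous_intros a_cont' I_cont J_cont that)
    \<comment> \<open>The derivative of \<open>D\<close> is
      \<open>- \<epsilon> * \<bar>a r \<omega>\<bar> * D r \<omega>\<close>, so the term of the
      majorant containing \<open>a\<close> has a multiple of \<open>D\<close> as primitive. Since
      \<open>D\<close> lies between 0 and 1, the bound is independent of \<omega>.\<close>
    have 7: "(LBINT r:{s..t}. \<bar>w \<psi>' r \<omega>\<bar>) \<le> exp (\<kappa> * t) * (\<kappa> * (t - s) + (\<epsilon> + \<bar>\<theta>\<bar>) / \<epsilon>)"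
      if \<omega>: "\<omega> \<in> space M" for \<omega>
    proof -
      have "(LBINT r:{s..t}. \<bar>w \<psi>' r \<omega>\<bar>)
          \<le> exp (\<kappa> * t) * (\<kappa> * t - (\<epsilon> + \<bar>\<theta>\<bar>) / \<epsilon> * D t \<omega>) - exp (\<kappa> * t) * (\<kappa> * s - (\<epsilon> + \<bar>\<theta>\<bar>) / \<epsilon> * D s \<omega>)"
      proof (rule LBINT_le_deriv[OF st(2)])
        show "continuous_on {s..t} (\<lambda>r. \<bar>w \<psi>' r \<omega>\<bar>)" by (intro continuous_on_rabs 6 \<omega>)
        show "continuous_on {s..t} (\<lambda>r. exp (\<kappa> * t) * (\<kappa> + (\<epsilon> + \<bar>\<theta>\<bar>) * (\<bar>a r \<omega>\<bar> * D r \<omega>)))"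
          unfolding D by (intro continuous_intros a_cont' J_cont \<omega>)
        fix r assume r: "r \<in> {s..t}"
        have "\<bar>(\<kappa> - \<epsilon> * \<bar>a r \<omega>\<bar>) * cos (\<theta> * I r \<omega> + \<psi>') - \<theta> * a r \<omega> * sin (\<theta> * I r \<omega> + \<psi>')\<bar>
            \<le> \<bar>\<kappa> - \<epsilon> * \<bar>a r \<omega>\<bar>\<bar> * \<bar>cos (\<theta> * I r \<omega> + \<psi>')\<bar> + \<bar>\<theta>\<bar> * \<bar>a r \<omega>\<bar> * \<bar>sin (\<theta> * I r \<omega> + \<psi>')\<bar>"
          by (metis abs_mult abs_triangle_ineq4)
        also have "\<dots> \<le> (\<kappa> + \<epsilon> * \<bar>a r \<omega>\<bar>) * 1 + \<bar>\<theta>\<bar> * \<bar>a r \<omega>\<bar> * 1"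
          by (intro add_mono mult_mono) (use \<kappa>0 \<epsilon> in \<open>auto simp: abs_le_iff\<close>)
        finally have *: "\<bar>(\<kappa> - \<epsilon> * \<bar>a r \<omega>\<bar>) * cos (\<theta> * I r \<omega> + \<psi>') - \<theta> * a r \<omega> * sin (\<theta> * I r \<omega> + \<psi>')\<bar>
            \<le> \<kappa> + (\<epsilon> + \<bar>\<theta>\<bar>) * \<bar>a r \<omega>\<bar>" by (simp add: algebra_simps)
        have "exp (\<kappa> * r) \<le> exp (\<kappa> * t)" using r \<kappa>0 by (simp add: mult_left_mono)
        then have "\<bar>w \<psi>' r \<omega>\<bar> \<le> D r \<omega> * exp (\<kappa> * t) * (\<kappa> + (\<epsilon> + \<bar>\<theta>\<bar>) * \<bar>a r \<omega>\<bar>)"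
          unfolding w_def abs_mult
          by (intro mult_mono[OF _ *[unfolded abs_mult]]) (use D_le1[of r \<omega>] * in \<open>auto simp: mult_left_mono abs_mult\<close>)
        also have "\<dots> = exp (\<kappa> * t) * (D r \<omega> * \<kappa> + (\<epsilon> + \<bar>\<theta>\<bar>) * (\<bar>a r \<omega>\<bar> * D r \<omega>))"
          by (simp add: algebra_simps)
        also have "\<dots> \<le> exp (\<kappa> * t) * (\<kappa> + (\<epsilon> + \<bar>\<theta>\<bar>) * (\<bar>a r \<omega>\<bar> * D r \<omega>))"
          using D_le1[of r \<omega>] \<kappa>0 by (simp add: mult_left_le_one_le)
        finally show "\<bar>w \<psi>' r \<omega>\<bar> \<le> exp (\<kappa> * t) * (\<kappa> + (\<epsilon> + \<bar>\<theta>\<bar>) * (\<bar>a r \<omega>\<bar> * D r \<omega>))" .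
        show "((\<lambda>r. exp (\<kappa> * t) * (\<kappa> * r - (\<epsilon> + \<bar>\<theta>\<bar>) / \<epsilon> * D r \<omega>)) has_real_derivative
            exp (\<kappa> * t) * (\<kappa> + (\<epsilon> + \<bar>\<theta>\<bar>) * (\<bar>a r \<omega>\<bar> * D r \<omega>))) (at r within {s..t})"
          unfolding D
          by (rule derivative_eq_intros J_deriv[OF r \<omega>] refl)+ (use \<epsilon> in \<open>simp add: field_simps\<close>)
      qed
      also have "\<dots> = exp (\<kappa> * t) * (\<kappa> * (t - s) + (\<epsilon> + \<bar>\<theta>\<bar>) / \<epsilon> * (D s \<omega> - D t \<omega>))"
        by (simp add: algebra_simps)
      also have "\<dots> \<le> exp (\<kappa> * t) * (\<kappa> * (t - s) + (\<epsilon> + \<bar>\<theta>\<bar>) / \<epsilon> * 1)"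
        using D_le1(1)[of s \<omega>] D_le1(2)[of t \<omega>] \<epsilon>
        by (intro mult_left_mono add_left_mono) auto
      finally show ?thesis by simp
    qed
    have 8: "((\<lambda>r. W \<psi>' r \<omega>) has_real_derivative w \<psi>' r \<omega>) (at r within {s..t})"
      if "r \<in> {s..t}" "\<omega> \<in> space M" for r \<omega>
      unfolding W_def w_def D
      by (rule derivative_eq_intros J_deriv[OF that] I_deriv[OF that] refl)+ (simp add: algebra_simps)
    note * = martingale_integration_by_parts[OF mart st 1 2 3 4 5 6 7 8 z_meas z_bound]
    show "integrable M (\<lambda>\<omega>. z \<omega> * (W \<psi>' t \<omega> * U \<psi> t \<omega> - W \<psi>' s \<omega> * U \<psi> s \<omega>
        - (LBINT r:{s..t}. U \<psi> r \<omega> * w \<psi>' r \<omega> + q \<psi> r \<omega> * W \<psi>' r \<omega>)))"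
      by (rule *(1))
    show "(\<integral>\<omega>. z \<omega> * (W \<psi>' t \<omega> * U \<psi> t \<omega> - W \<psi>' s \<omega> * U \<psi> s \<omega>
        - (LBINT r:{s..t}. U \<psi> r \<omega> * w \<psi>' r \<omega> + q \<psi> r \<omega> * W \<psi>' r \<omega>)) \<partial>M) = 0"
      by (rule *(2))
  qed
  \<comment> \<open>The angle of \<open>E\<close> is \<open>\<theta> * X + \<phi>\<close> minus
    \<open>\<theta> * I\<close>. Phase 0 gives the product of cosines, and shifting both phases by
    \<open>- pi / 2\<close> gives the product of sines.\<close>
  have T: "T \<omega> = V \<phi> 0 \<omega> + V (\<phi> - pi / 2) (- pi / 2) \<omega>" if \<omega>: "\<omega> \<in> space M" for \<omega>
  proof -
    have shift: "cos (x + (y - pi / 2)) = sin (x + y)" "sin (x + (y - pi / 2)) = - cos (x + y)"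
      "cos (x + - pi / 2) = sin x" "sin (x + - pi / 2) = - cos x" for x y :: real
      by (simp_all add: add_diff_eq cos_diff sin_diff cos_add sin_add)
    have cosR: "cos (\<theta> * R r \<omega> + \<phi>) = cos (\<theta> * X r \<omega> + \<phi>) * cos (\<theta> * I r \<omega>)
        + sin (\<theta> * X r \<omega> + \<phi>) * sin (\<theta> * I r \<omega>)" for r
    proof -
      have "\<theta> * R r \<omega> + \<phi> = (\<theta> * X r \<omega> + \<phi>) - \<theta> * I r \<omega>" by (simp add: R algebra_simps)
      then show ?thesis by (simp only: cos_diff)
    qed
    have WU: "W 0 r \<omega> * U \<phi> r \<omega> + W (- pi / 2) r \<omega> * U (\<phi> - pi / 2) r \<omega> = D r \<omega> * E r \<omega>" for r
      unfolding W_def U_def E_def shift cosR by (simp add: algebra_simps)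
    \<comment> \<open>The drift terms from \<open>q\<close> and \<open>w\<close> cancel, and
      \<kappa> is chosen to cancel the second-order term; what survives is the derivative of the
      damping.\<close>
    have int: "(U \<phi> r \<omega> * w 0 r \<omega> + q \<phi> r \<omega> * W 0 r \<omega>)
        + (U (\<phi> - pi / 2) r \<omega> * w (- pi / 2) r \<omega> + q (\<phi> - pi / 2) r \<omega> * W (- pi / 2) r \<omega>)
        = - (\<epsilon> * \<bar>a r \<omega>\<bar> * D r \<omega> * E r \<omega>)" for r
      unfolding W_def U_def E_def q_def w_def shift cosR \<kappa>_def[symmetric] by (simp add: algebra_simps)
    have cont: "continuous_on {s..t} (\<lambda>r. U \<psi> r \<omega> * w \<psi>' r \<omega> + q \<psi> r \<omega> * W \<psi>' r \<omega>)" for \<psi> \<psi>'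
      unfolding W_def U_def q_def w_def D
      by (intro continuous_intros a_cont' X_cont' I_cont J_cont \<omega>)
    have "(LBINT r:{s..t}. U \<phi> r \<omega> * w 0 r \<omega> + q \<phi> r \<omega> * W 0 r \<omega>)
        + (LBINT r:{s..t}. U (\<phi> - pi / 2) r \<omega> * w (- pi / 2) r \<omega> + q (\<phi> - pi / 2) r \<omega> * W (- pi / 2) r \<omega>)
        = (LBINT r:{s..t}. - (\<epsilon> * \<bar>a r \<omega>\<bar> * D r \<omega> * E r \<omega>))"
      unfolding int[symmetric]
      by (intro set_integral_add(2)[symmetric] borel_integrable_atLeastAtMost' cont)
    also have "\<dots> = - (LBINT r:{s..t}. \<epsilon> * \<bar>a r \<omega>\<bar> * D r \<omega> * E r \<omega>)"
      unfolding D E_def R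
      by (intro set_integral_uminus borel_integrable_atLeastAtMost' continuous_intros a_cont' X_cont' I_cont J_cont \<omega>)
    finally show ?thesis
      unfolding T_def V_def WU[symmetric]
      by (simp add: distrib_left[symmetric] right_diff_distrib[symmetric] del: distrib_left_NO_MATCH)
  qed
  have eq: "T \<omega> = (\<lambda>\<omega>. V \<phi> 0 \<omega> + V (\<phi> - pi / 2) (- pi / 2) \<omega>) \<omega>" if "\<omega> \<in> space M" for \<omega>
    using T[OF that] .
  show "integrable M T"
    by (subst Bochner_Integration.integrable_cong[OF refl eq]) (use V in auto)
  show "(\<integral>\<omega>. T \<omega> \<partial>M) = 0"
    by (subst Bochner_Integration.integral_cong[OF refl eq]) (use V in auto)
qed

lemma R_measurable: "0 \<le> t \<Longrightarrow> R t \<in> borel_measurable M"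
  using F_measurable_M[OF _ R_meas] by simp

text \<open>The damped identity is used with \<epsilon> equal to \<open>1 / (n + 1)\<close>. As
  \<open>n\<close> grows, \<open>D n\<close> tends to 1 and its increment, which controls the error
  integral \<open>i n\<close>, tends to 0.\<close>

lemma exp_cos_expectation:
  fixes \<theta> \<phi> :: real
  assumes st: "0 \<le> s" "s \<le> t" and v: "0 \<le> v"
    and z_meas: "z \<in> borel_measurable (F s)"
    and z_bound: "\<And>\<omega>. \<omega> \<in> space M \<Longrightarrow> \<bar>z \<omega>\<bar> \<le> L"
  defines "\<kappa> \<equiv> \<theta>\<^sup>2 * v / 2"
  shows "(\<integral>\<omega>. z \<omega> * (exp (\<kappa> * t) * cos (\<theta> * R t \<omega> + \<phi>)) \<partial>M)
    = (\<integral>\<omega>. z \<omega> * (exp (\<kappa> * s) * cos (\<theta> * R s \<omega> + \<phi>)) \<partial>M)"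
proof -
  define J where "J r \<omega> = (LBINT u:{0..r}. \<bar>a u \<omega>\<bar>)" for r \<omega>
  define D where "D n r \<omega> = exp (- (1 / real (Suc n)) * J r \<omega>)" for n r \<omega>
  define E where "E r \<omega> = exp (\<kappa> * r) * cos (\<theta> * R r \<omega> + \<phi>)" for r \<omega>
  define i where "i n \<omega> = (LBINT r:{s..t}. 1 / real (Suc n) * \<bar>a r \<omega>\<bar> * D n r \<omega> * E r \<omega>)" for n \<omega>
  define T where "T n \<omega> = z \<omega> * (D n t \<omega> * E t \<omega> - D n s \<omega> * E s \<omega> + i n \<omega>)" for n \<omega>
  have T: "integrable M (T n)" "(\<integral>\<omega>. T n \<omega> \<partial>M) = 0" for n
    using damped_expectation[OF st _ v z_meas z_bound, of "1 / real (Suc n)" \<theta> \<phi>]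
    unfolding T_def[abs_def] i_def D_def E_def J_def \<kappa>_def by auto
  have t0: "0 \<le> t" using st by simp
  have \<kappa>0: "0 \<le> \<kappa>" using v by (simp add: \<kappa>_def)
  have sub: "{s..t} \<subseteq> {0..}" "{s..t} \<subseteq> {0..t}" "{0..t} \<subseteq> {0..}" using st by auto
  have J_nonneg: "0 \<le> J r \<omega>" for r \<omega>
    unfolding J_def set_lebesgue_integral_def by (rule Bochner_Integration.integral_nonneg) auto
  have D_le1: "D n r \<omega> \<le> 1" "0 \<le> D n r \<omega>" for n r \<omega>
    using J_nonneg[of r \<omega>] by (simp_all add: D_def)
  have E_le: "\<bar>E r \<omega>\<bar> \<le> exp (\<kappa> * t)" if "r \<le> t" for r \<omega>
  proof -
    have "exp (\<kappa> * r) * \<bar>cos (\<theta> * R r \<omega> + \<phi>)\<bar> \<le> exp (\<kappa> * t) * 1"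
      by (intro mult_mono) (use that \<kappa>0 in \<open>auto simp: mult_left_mono\<close>)
    then show ?thesis by (simp add: E_def abs_mult)
  qed
  \<comment> \<open>A primitive of the majorant is
    \<open>- exp (\<kappa> * t) * D n r \<omega>\<close>, so the error is bounded by the drop of the
    damping factor over the interval.\<close>
  have i_le: "\<bar>i n \<omega>\<bar> \<le> exp (\<kappa> * t) * (D n s \<omega> - D n t \<omega>)" if \<omega>: "\<omega> \<in> space M" for n \<omega>
  proof -
    have J_deriv: "((\<lambda>r. J r \<omega>) has_real_derivative \<bar>a r \<omega>\<bar>) (at r within {s..t})"
      if "r \<in> {s..t}" for r
      unfolding J_def
      by (rule DERIV_subset[OF LBINT_has_derivative[where b = t]])
        (use that sub \<omega> in \<open>auto intro!: continuous_on_rabs intro: continuous_on_subset[OF a_cont]\<close>)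
    note cont = DERIV_continuous_on[OF J_deriv] continuous_on_subset[OF a_cont[OF \<omega>] sub(1)]
      continuous_on_subset[OF R_cont[OF \<omega>] sub(1)]
    have "\<bar>i n \<omega>\<bar> \<le> - exp (\<kappa> * t) * D n t \<omega> - (- exp (\<kappa> * t) * D n s \<omega>)"
      unfolding i_def
    proof (rule abs_LBINT_le_deriv[OF st(2)])
      show "continuous_on {s..t} (\<lambda>r. 1 / real (Suc n) * \<bar>a r \<omega>\<bar> * D n r \<omega> * E r \<omega>)"
        unfolding D_def E_def by (intro continuous_intros cont)
      show "continuous_on {s..t} (\<lambda>r. exp (\<kappa> * t) * (1 / real (Suc n) * \<bar>a r \<omega>\<bar> * D n r \<omega>))"
        unfolding D_def by (intro continuous_intros cont)
      fix r assume r: "r \<in> {s..t}"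
      have "1 / real (Suc n) * \<bar>a r \<omega>\<bar> * D n r \<omega> * \<bar>E r \<omega>\<bar>
          \<le> 1 / real (Suc n) * \<bar>a r \<omega>\<bar> * D n r \<omega> * exp (\<kappa> * t)"
        using E_le[of r \<omega>] D_le1[of n r \<omega>] r by (intro mult_left_mono) auto
      then show "\<bar>1 / real (Suc n) * \<bar>a r \<omega>\<bar> * D n r \<omega> * E r \<omega>\<bar>
          \<le> exp (\<kappa> * t) * (1 / real (Suc n) * \<bar>a r \<omega>\<bar> * D n r \<omega>)"
        using D_le1[of n r \<omega>] by (simp add: abs_mult mult_ac)
      show "((\<lambda>r. - exp (\<kappa> * t) * D n r \<omega>) has_real_derivative
          exp (\<kappa> * t) * (1 / real (Suc n) * \<bar>a r \<omega>\<bar> * D n r \<omega>)) (at r within {s..t})"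
        unfolding D_def by (rule derivative_eq_intros J_deriv[OF r] refl)+ simp
    qed
    then show ?thesis by (simp add: algebra_simps)
  qed
  have D_lim: "(\<lambda>n. D n r \<omega>) \<longlonglongrightarrow> 1" for r \<omega>
  proof -
    have "(\<lambda>n. - (1 / real (Suc n)) * J r \<omega>) \<longlonglongrightarrow> - 0 * J r \<omega>"
      using LIMSEQ_inverse_real_of_nat by (intro tendsto_intros) (simp add: inverse_eq_divide)
    then have "(\<lambda>n. exp (- (1 / real (Suc n)) * J r \<omega>)) \<longlonglongrightarrow> exp (- 0 * J r \<omega>)"
      by (rule tendsto_exp)
    then show ?thesis by (simp add: D_def)
  qed
  have i_lim: "(\<lambda>n. i n \<omega>) \<longlonglongrightarrow> 0" if "\<omega> \<in> space M" for \<omega>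
  proof (rule Lim_null_comparison)
    show "\<forall>\<^sub>F n in sequentially. norm (i n \<omega>) \<le> exp (\<kappa> * t) * (D n s \<omega> - D n t \<omega>)"
      using i_le[OF that] by simp
    have "(\<lambda>n. exp (\<kappa> * t) * (D n s \<omega> - D n t \<omega>)) \<longlonglongrightarrow> exp (\<kappa> * t) * (1 - 1)"
      by (intro tendsto_intros D_lim)
    then show "(\<lambda>n. exp (\<kappa> * t) * (D n s \<omega> - D n t \<omega>)) \<longlonglongrightarrow> 0" by simp
  qed
  have R_M[measurable]: "R s \<in> borel_measurable M" "R t \<in> borel_measurable M" "z \<in> borel_measurable M"
    using st t0 R_measurable F_measurable_M[OF st(1) z_meas] by auto
  have zE: "integrable M (\<lambda>\<omega>. z \<omega> * E r \<omega>)" if "r \<in> {s,t}" for r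
  proof (rule integrable_const_bound[where B = "L * exp (\<kappa> * t)"])
    show "AE \<omega> in M. norm (z \<omega> * E r \<omega>) \<le> L * exp (\<kappa> * t)"
    proof (rule AE_I2)
      fix \<omega> assume "\<omega> \<in> space M"
      from z_bound[OF this] E_le[of r \<omega>] that st show "norm (z \<omega> * E r \<omega>) \<le> L * exp (\<kappa> * t)"
        by (auto simp: abs_mult intro!: mult_mono')
    qed
    show "(\<lambda>\<omega>. z \<omega> * E r \<omega>) \<in> borel_measurable M"
      using that unfolding E_def by auto
  qed
  have "(\<lambda>n. \<integral>\<omega>. T n \<omega> \<partial>M) \<longlonglongrightarrow> (\<integral>\<omega>. z \<omega> * E t \<omega> - z \<omega> * E s \<omega> \<partial>M)"
  \<comment> \<open>The two boundary terms and the error integral contribute one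
    \<open>exp (\<kappa> * t)\<close> each.\<close>
  proof (rule integral_dominated_convergence[where w = "\<lambda>_. L * (3 * exp (\<kappa> * t))"])
    show "(\<lambda>\<omega>. z \<omega> * E t \<omega> - z \<omega> * E s \<omega>) \<in> borel_measurable M"
      unfolding E_def by measurable
    show "T n \<in> borel_measurable M" for n using T(1)[of n] by (rule borel_measurable_integrable)
    show "integrable M (\<lambda>_. L * (3 * exp (\<kappa> * t)))" by simp
    show "AE \<omega> in M. (\<lambda>n. T n \<omega>) \<longlonglongrightarrow> z \<omega> * E t \<omega> - z \<omega> * E s \<omega>"
    proof (rule AE_I2)
      fix \<omega> assume "\<omega> \<in> space M"
      then have "(\<lambda>n. T n \<omega>) \<longlonglongrightarrow> z \<omega> * (1 * E t \<omega> - 1 * E s \<omega> + 0)"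
        unfolding T_def by (intro tendsto_intros D_lim i_lim)
      then show "(\<lambda>n. T n \<omega>) \<longlonglongrightarrow> z \<omega> * E t \<omega> - z \<omega> * E s \<omega>"
        by (simp add: right_diff_distrib)
    qed
    show "AE \<omega> in M. norm (T n \<omega>) \<le> L * (3 * exp (\<kappa> * t))" for n
    proof (rule AE_I2)
      fix \<omega> assume \<omega>: "\<omega> \<in> space M"
      have le: "D n r \<omega> * \<bar>E r \<omega>\<bar> \<le> 1 * exp (\<kappa> * t)" if "r \<le> t" for r
        using D_le1[of n r \<omega>] E_le[OF that, of \<omega>] by (intro mult_mono) auto
      have "\<bar>i n \<omega>\<bar> \<le> exp (\<kappa> * t) * 1"
        by (rule order_trans[OF i_le[OF \<omega>] mult_left_mono])
          (use D_le1(1)[of n s \<omega>] D_le1(2)[of n t \<omega>] in auto)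
      moreover have "\<bar>D n t \<omega> * E t \<omega>\<bar> \<le> exp (\<kappa> * t)" "\<bar>D n s \<omega> * E s \<omega>\<bar> \<le> exp (\<kappa> * t)"
        using le[of t] le[of s] st D_le1[of n s \<omega>] D_le1[of n t \<omega>] by (auto simp: abs_mult)
      ultimately have "\<bar>D n t \<omega> * E t \<omega> - D n s \<omega> * E s \<omega> + i n \<omega>\<bar> \<le> 3 * exp (\<kappa> * t)"
        by (smt (verit))
      then show "norm (T n \<omega>) \<le> L * (3 * exp (\<kappa> * t))"
        unfolding T_def real_norm_def abs_mult
        by (intro mult_mono'[OF z_bound[OF \<omega>]]) auto
    qed
  qed
  then have "(\<integral>\<omega>. z \<omega> * E t \<omega> - z \<omega> * E s \<omega> \<partial>M) = 0"
    by (simp add: T LIMSEQ_const_iff)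
  then show ?thesis
    using zE[of s] zE[of t] by (simp add: E_def)
qed

text \<open>This is the conditional characteristic function of an increment. By the addition formula
  the cosine splits into terms at time \<open>t\<close> with weights
  \<open>z * cos (\<theta> * R s)\<close> and \<open>z * sin (\<theta> * R s)\<close>, which are
  bounded and known at time \<open>s\<close>.\<close>

lemma increment_cos_expectation:
  assumes st: "0 \<le> s" "s \<le> t" and v: "0 \<le> v"
    and z_meas: "z \<in> borel_measurable (F s)"
    and z_bound: "\<And>\<omega>. \<omega> \<in> space M \<Longrightarrow> \<bar>z \<omega>\<bar> \<le> L"
  shows "(\<integral>\<omega>. z \<omega> * cos (\<theta> * (R t \<omega> - R s \<omega>) + \<phi>) \<partial>M)
    = exp (- (\<theta>\<^sup>2 * v / 2) * (t - s)) * cos \<phi> * (\<integral>\<omega>. z \<omega> \<partial>M)"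
proof -
  define \<kappa> where "\<kappa> = \<theta>\<^sup>2 * v / 2"
  define p where "p b \<omega> = z \<omega> * cos (\<theta> * R s \<omega> - b)" for b \<omega>
  have L: "p b \<in> borel_measurable (F s)" "\<And>\<omega>. \<omega> \<in> space M \<Longrightarrow> \<bar>p b \<omega>\<bar> \<le> L" for b
  proof -
    show "p b \<in> borel_measurable (F s)"
      using R_meas[OF st(1)] z_meas unfolding p_def by measurable
    show "\<bar>p b \<omega>\<bar> \<le> L" if "\<omega> \<in> space M" for \<omega>
    proof -
      have "\<bar>z \<omega>\<bar> * \<bar>cos (\<theta> * R s \<omega> - b)\<bar> \<le> L * 1"
        using z_bound[OF that] by (intro mult_mono') auto
      then show ?thesis by (simp add: p_def abs_mult)
    qed
  qed
  have t0: "0 \<le> t" using st by simp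
  have [measurable]: "R s \<in> borel_measurable M" "R t \<in> borel_measurable M" "p b \<in> borel_measurable M" for b
    using st t0 R_measurable F_measurable_M[OF st(1) L(1)] by auto
  have int: "integrable M (\<lambda>\<omega>. p b \<omega> * (exp c * cos (\<theta> * R r \<omega> + \<psi>)))" if "r \<in> {s,t}" for b c r \<psi>
  proof (rule integrable_const_bound[where B = "L * (exp c * 1)"])
    show "AE \<omega> in M. norm (p b \<omega> * (exp c * cos (\<theta> * R r \<omega> + \<psi>))) \<le> L * (exp c * 1)"
      unfolding real_norm_def abs_mult by (intro AE_I2 mult_mono' L) auto
    show "(\<lambda>\<omega>. p b \<omega> * (exp c * cos (\<theta> * R r \<omega> + \<psi>))) \<in> borel_measurable M"
      using that by auto
  qed
  have split: "p 0 \<omega> * (e * cos (\<theta> * R r \<omega> + \<phi>)) + p (pi / 2) \<omega> * (e * cos (\<theta> * R r \<omega> + (\<phi> - pi / 2)))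
      = e * (z \<omega> * cos (\<theta> * (R r \<omega> - R s \<omega>) + \<phi>))" for r \<omega> e
  proof -
    have "\<theta> * (R r \<omega> - R s \<omega>) + \<phi> = (\<theta> * R r \<omega> + \<phi>) - \<theta> * R s \<omega>" by (simp add: algebra_simps)
    then have "cos (\<theta> * (R r \<omega> - R s \<omega>) + \<phi>) = cos (\<theta> * R r \<omega> + \<phi>) * cos (\<theta> * R s \<omega>)
        + sin (\<theta> * R r \<omega> + \<phi>) * sin (\<theta> * R s \<omega>)" by (simp only: cos_diff)
    moreover have "cos (\<theta> * R r \<omega> + (\<phi> - pi / 2)) = sin (\<theta> * R r \<omega> + \<phi>)"
      "cos (\<theta> * R s \<omega> - pi / 2) = sin (\<theta> * R s \<omega>)"
      by (simp_all add: add_diff_eq cos_diff)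
    ultimately show ?thesis by (simp add: p_def algebra_simps)
  qed
  have "exp (\<kappa> * t) * (\<integral>\<omega>. z \<omega> * cos (\<theta> * (R t \<omega> - R s \<omega>) + \<phi>) \<partial>M)
      = (\<integral>\<omega>. p 0 \<omega> * (exp (\<kappa> * t) * cos (\<theta> * R t \<omega> + \<phi>)) \<partial>M)
      + (\<integral>\<omega>. p (pi / 2) \<omega> * (exp (\<kappa> * t) * cos (\<theta> * R t \<omega> + (\<phi> - pi / 2))) \<partial>M)"
    using int by (subst Bochner_Integration.integral_add[symmetric]) (auto simp: split)
  also have "\<dots> = (\<integral>\<omega>. p 0 \<omega> * (exp (\<kappa> * s) * cos (\<theta> * R s \<omega> + \<phi>)) \<partial>M)
      + (\<integral>\<omega>. p (pi / 2) \<omega> * (exp (\<kappa> * s) * cos (\<theta> * R s \<omega> + (\<phi> - pi / 2))) \<partial>M)"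
    unfolding \<kappa>_def
    using exp_cos_expectation[OF st v L, of 0 \<theta> \<phi>] exp_cos_expectation[OF st v L, of "pi / 2" \<theta> "\<phi> - pi / 2"]
    by simp
  \<comment> \<open>Read backwards at time \<open>s\<close>, the same splitting has increment zero,
    so only \<open>cos \<phi>\<close> remains.\<close>
  also have "\<dots> = exp (\<kappa> * s) * (\<integral>\<omega>. z \<omega> * cos (\<theta> * (R s \<omega> - R s \<omega>) + \<phi>) \<partial>M)"
    using int by (subst Bochner_Integration.integral_add[symmetric]) (auto simp: split)
  also have "\<dots> = exp (\<kappa> * t) * (exp (- \<kappa> * (t - s)) * cos \<phi> * (\<integral>\<omega>. z \<omega> \<partial>M))"
  proof -
    have "exp (\<kappa> * s) = exp (\<kappa> * t) * exp (- \<kappa> * (t - s))"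
      by (simp add: exp_add[symmetric] algebra_simps)
    then show ?thesis by simp
  qed
  finally show ?thesis by (simp add: \<kappa>_def)
qed

end

section \<open>Gaussian increments and independence\<close>

lemma (in prob_space) char_distr:
  assumes [measurable]: "Y \<in> borel_measurable M"
  shows "char (distr M borel Y) \<theta> = Complex (\<integral>\<omega>. cos (\<theta> * Y \<omega>) \<partial>M) (\<integral>\<omega>. sin (\<theta> * Y \<omega>) \<partial>M)"
proof -
  have int: "integrable M (\<lambda>\<omega>. iexp (\<theta> * Y \<omega>))"
    by (rule integrable_const_bound[where B = 1]) auto
  have eq: "char (distr M borel Y) \<theta> = (\<integral>\<omega>. iexp (\<theta> * Y \<omega>) \<partial>M)"
    unfolding char_def by (rule integral_distr) auto
  show ?thesis
    unfolding eq using integral_Re[OF int] integral_Im[OF int]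
    by (intro complex_eqI) (simp_all add: Re_exp Im_exp)
qed

text \<open>Conditionally on \<open>A\<close> the variable \<open>Y\<close> keeps its characteristic
  function, hence its law by Levy's theorem. The conditional measure requires positive
  \<open>prob A\<close>; for a null \<open>A\<close> both sides vanish.\<close>

lemma (in prob_space) prob_Int_vimage_eq_mult:
  assumes Y[measurable]: "Y \<in> borel_measurable M" and A[measurable]: "A \<in> events"
    and "B \<in> sets borel"
    and c: "\<And>\<theta>. (\<integral>\<omega>. indicator A \<omega> * cos (\<theta> * Y \<omega>) \<partial>M) = prob A * (\<integral>\<omega>. cos (\<theta> * Y \<omega>) \<partial>M)"
    and s: "\<And>\<theta>. (\<integral>\<omega>. indicator A \<omega> * sin (\<theta> * Y \<omega>) \<partial>M) = prob A * (\<integral>\<omega>. sin (\<theta> * Y \<omega>) \<partial>M)"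
  shows "prob (A \<inter> (Y -` B \<inter> space M)) = prob A * prob (Y -` B \<inter> space M)"
proof (cases "prob A = 0")
  case True
  then have "prob (A \<inter> (Y -` B \<inter> space M)) \<le> 0"
    using finite_measure_mono[of "A \<inter> (Y -` B \<inter> space M)" A] by auto
  then show ?thesis using True by (simp add: measure_le_0_iff)
next
  case False
  then have pos: "prob A > 0" by (simp add: zero_less_measure_iff)
  let ?Q = "uniform_measure M A"
  interpret Q: prob_space ?Q
    using pos by (intro prob_space_uniform_measure) (auto simp: emeasure_eq_measure)
  have YQ[measurable]: "Y \<in> borel_measurable ?Q" by simp
  have Q: "?Q = density M (\<lambda>\<omega>. ennreal (indicator A \<omega> / prob A))"
    unfolding uniform_measure_def
    by (intro arg_cong[where f = "density M"] ext)
      (use pos in \<open>auto simp: emeasure_eq_measure divide_ennreal indicator_def simp flip: ennreal_1\<close>)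
  have int: "(\<integral>\<omega>. f \<omega> \<partial>?Q) = (\<integral>\<omega>. indicator A \<omega> * f \<omega> \<partial>M) / prob A"
    if "f \<in> borel_measurable M" for f :: "'a \<Rightarrow> real"
    unfolding Q using that by (subst integral_real_density) auto
  have "distr ?Q borel Y = distr M borel Y"
  proof (rule Levy_uniqueness)
    show "real_distribution (distr ?Q borel Y)" by (rule Q.real_distribution_distr) simp
    show "real_distribution (distr M borel Y)" by (rule real_distribution_distr) simp
    show "char (distr ?Q borel Y) = char (distr M borel Y)"
      unfolding char_distr[OF Y] Q.char_distr[OF YQ]
      by (rule ext) (use False in \<open>simp add: int c s char_distr[OF Y] Q.char_distr[OF YQ]\<close>)
  qed
  then have "measure (distr ?Q borel Y) B = measure (distr M borel Y) B" by simp
  then have "Q.prob (Y -` B \<inter> space M) = prob (Y -` B \<inter> space M)"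
    using \<open>B \<in> sets borel\<close> by (simp add: measure_distr)
  then show ?thesis
    using pos \<open>B \<in> sets borel\<close>
    by (simp add: measure_uniform_measure emeasure_eq_measure field_simps)
qed

section \<open>The law of the increments of \<open>R\<close>\<close>

context trigonometric_martingale_problem
begin

text \<open>Comparing the weights \<open>indicator A\<close> and 1 in
  \<open>increment_cos_expectation\<close> factors the expectation; the phases 0 and
  \<open>- pi / 2\<close> supply the cosine and the sine.\<close>

lemma increment_independent:
  assumes st: "0 \<le> s" "s \<le> t" and v: "0 \<le> v"
    and A: "A \<in> sets (F s)" and "B \<in> sets borel"
  shows "prob (A \<inter> ((\<lambda>\<omega>. R t \<omega> - R s \<omega>) -` B \<inter> space M))
    = prob A * prob ((\<lambda>\<omega>. R t \<omega> - R s \<omega>) -` B \<inter> space M)"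
proof (rule prob_Int_vimage_eq_mult[OF _ _ \<open>B \<in> sets borel\<close>])
  have [measurable]: "R t \<in> borel_measurable M" "R s \<in> borel_measurable M"
    using R_measurable st by auto
  show "(\<lambda>\<omega>. R t \<omega> - R s \<omega>) \<in> borel_measurable M" by measurable
  show AM: "A \<in> events" using A subalgebra_F[OF st(1)] by (auto simp: subalgebra_def)
  have 1: "(\<integral>\<omega>. indicator A \<omega> * cos (\<theta> * (R t \<omega> - R s \<omega>) + \<phi>) \<partial>M)
      = prob A * (\<integral>\<omega>. cos (\<theta> * (R t \<omega> - R s \<omega>) + \<phi>) \<partial>M)" for \<theta> \<phi>
    using increment_cos_expectation[OF st v, of "indicator A" 1 \<theta> \<phi>]
      increment_cos_expectation[OF st v, of "\<lambda>_. 1" 1 \<theta> \<phi>] A AM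
    by (simp add: prob_space indicator_le_1)
  show "(\<integral>\<omega>. indicator A \<omega> * cos (\<theta> * (R t \<omega> - R s \<omega>)) \<partial>M)
      = prob A * (\<integral>\<omega>. cos (\<theta> * (R t \<omega> - R s \<omega>)) \<partial>M)" for \<theta>
    using 1[of \<theta> 0] by simp
  show "(\<integral>\<omega>. indicator A \<omega> * sin (\<theta> * (R t \<omega> - R s \<omega>)) \<partial>M)
      = prob A * (\<integral>\<omega>. sin (\<theta> * (R t \<omega> - R s \<omega>)) \<partial>M)" for \<theta>
    using 1[of \<theta> "- pi / 2"] by (simp add: cos_add cos_diff)
qed

text \<open>After division by the standard deviation \<open>d\<close> the characteristic function is
  that of the standard normal law; the result is then rescaled.\<close>

lemma increment_normal:
  assumes st: "0 \<le> s" "s < t" and v: "0 < v"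
  shows "distributed M lborel (\<lambda>\<omega>. (R t \<omega> - R s \<omega>) / sqrt v) (normal_density 0 (sqrt (t - s)))"
proof -
  define d where "d = sqrt (v * (t - s))"
  have d: "d > 0" "d\<^sup>2 = v * (t - s)" using st v by (auto simp: d_def)
  have [measurable]: "R t \<in> borel_measurable M" "R s \<in> borel_measurable M"
    using R_measurable st by auto
  define Y where "Y \<omega> = (R t \<omega> - R s \<omega>) / d" for \<omega>
  have Y[measurable]: "Y \<in> borel_measurable M" unfolding Y_def by measurable
  have exp: "(\<integral>\<omega>. cos (\<theta> * Y \<omega> + \<phi>) \<partial>M) = exp (- \<theta>\<^sup>2 / 2) * cos \<phi>" for \<theta> \<phi>
  proof -
    have "(\<theta> / d)\<^sup>2 * v / 2 * (t - s) = \<theta>\<^sup>2 / d\<^sup>2 * (v * (t - s)) / 2"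
      by (simp add: power_divide)
    also have "\<dots> = \<theta>\<^sup>2 / 2" unfolding d(2)[symmetric] using d(1) by simp
    finally have "(\<theta> / d)\<^sup>2 * v / 2 * (t - s) = \<theta>\<^sup>2 / 2" .
    then show ?thesis
      using increment_cos_expectation[of s t "\<lambda>_. 1" 1 "\<theta> / d" \<phi>] st v
      by (simp add: Y_def prob_space)
  qed
  have sin: "(\<integral>\<omega>. sin (\<theta> * Y \<omega>) \<partial>M) = 0" for \<theta>
    using exp[of \<theta> "- pi / 2"] by (simp add: cos_add cos_diff)
  have "distr M borel Y = std_normal_distribution"
  proof (rule Levy_uniqueness)
    show "real_distribution (distr M borel Y)" by (rule real_distribution_distr) simp
    show "real_distribution std_normal_distribution" by (rule real_dist_normal_dist)
    show "char (distr M borel Y) = char std_normal_distribution"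
      using exp[of _ 0]
      by (intro ext) (simp add: char_distr[OF Y] char_std_normal_distribution sin complex_of_real_def)
  qed
  then have "distributed M lborel Y std_normal_density"
    by (simp add: distributed_def cong: distr_cong)
  moreover have "Y = (\<lambda>\<omega>. ((R t \<omega> - R s \<omega>) / sqrt v - 0) / sqrt (t - s))"
    by (simp add: Y_def fun_eq_iff d_def real_sqrt_mult)
  ultimately show ?thesis
    using st by (subst normal_standard_normal_convert) auto
qed

text \<open>The characteristic function is identically 1, so the law of the increment is the point
  mass at 0. This serves test functions vanishing at \<open>c\<close>.\<close>

lemma increment_zero:
  assumes st: "0 \<le> s" "s \<le> t" and v: "v = 0"
  shows "AE \<omega> in M. R t \<omega> = R s \<omega>"
proof -
  have [measurable]: "R t \<in> borel_measurable M" "R s \<in> borel_measurable M"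
    using R_measurable st by auto
  define Y where "Y \<omega> = R t \<omega> - R s \<omega>" for \<omega>
  have Y[measurable]: "Y \<in> borel_measurable M" unfolding Y_def by measurable
  have exp: "(\<integral>\<omega>. cos (\<theta> * Y \<omega> + \<phi>) \<partial>M) = cos \<phi>" for \<theta> \<phi>
    using increment_cos_expectation[of s t "\<lambda>_. 1" 1 "\<theta>" \<phi>] st v
    by (simp add: Y_def prob_space)
  have sin: "(\<integral>\<omega>. sin (\<theta> * Y \<omega>) \<partial>M) = 0" for \<theta>
    using exp[of \<theta> "- pi / 2"] by (simp add: cos_add cos_diff)
  have "distr M borel Y = distr M borel (\<lambda>_. 0)"
  proof (rule Levy_uniqueness)
    show "real_distribution (distr M borel Y)" by (rule real_distribution_distr) simp
    show "real_distribution (distr M borel (\<lambda>_. 0))" by (rule real_distribution_distr) simp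
    show "char (distr M borel Y) = char (distr M borel (\<lambda>_. 0))"
      using exp[of _ 0]
      by (intro ext) (simp add: char_distr[OF Y] char_distr[of "\<lambda>_. 0"] sin prob_space del: distr_const)
  qed
  then have "measure (distr M borel Y) {0} = measure (distr M borel (\<lambda>_. 0::real)) {0}" by (simp only:)
  then have "prob (Y -` {0} \<inter> space M) = 1"
    by (simp add: measure_distr prob_space vimage_def del: distr_const)
  then have "AE \<omega> in M. \<omega> \<in> Y -` {0} \<inter> space M"
    by (subst (asm) prob_eq_1) auto
  then show ?thesis by (auto simp: Y_def)
qed

text \<open>The initial value is subtracted because \<open>brownian_motion\<close> asks for a start
  at 0 for every \<omega>, not merely almost surely.\<close>

lemma brownian_motion_R:
  assumes v: "0 < v"
  shows "brownian_motion M (\<lambda>t \<omega>. (R t \<omega> - R 0 \<omega>) / sqrt v)"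
  unfolding brownian_motion_def
proof (intro conjI allI impI ballI)
  have [measurable]: "R t \<in> borel_measurable M" if "0 \<le> t" for t
    using R_measurable that by auto
  show "(\<lambda>\<omega>. (R t \<omega> - R 0 \<omega>) / sqrt v) \<in> borel_measurable M" if "0 \<le> t" for t
    using that by measurable
  fix \<omega> assume "\<omega> \<in> space M"
  then show "continuous_on {0..} (\<lambda>t. (R t \<omega> - R 0 \<omega>) / sqrt v)"
    using v by (intro continuous_intros R_cont) auto
next
  fix s t :: real assume "0 \<le> s \<and> s < t"
  then show "distributed M lborel (\<lambda>\<omega>. (R t \<omega> - R 0 \<omega>) / sqrt v - (R s \<omega> - R 0 \<omega>) / sqrt v)
      (\<lambda>x. ennreal (normal_density 0 (sqrt (t - s)) x))"
    using increment_normal[of s t] v by (simp add: diff_divide_distrib)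
next
  fix n and \<tau> :: "nat \<Rightarrow> real" assume \<tau>: "0 \<le> \<tau> 0 \<and> (\<forall>i<n. \<tau> i \<le> \<tau> (Suc i))"
  define Y where "Y i \<omega> = R (\<tau> (Suc i)) \<omega> - R (\<tau> i) \<omega>" for i \<omega>
  have \<tau>0: "0 \<le> \<tau> i" if "i \<le> n" for i
    using that by (induction i) (use \<tau> in \<open>auto intro: order_trans\<close>)
  have Y_F: "Y i \<in> borel_measurable (F (\<tau> (Suc i)))" if "i < n" for i
    unfolding Y_def
    by (intro borel_measurable_diff R_meas F_measurable_mono[of "\<tau> i" "\<tau> (Suc i)"])
      (use \<tau>0 \<tau> that in auto)
  have Y_M: "Y i \<in> borel_measurable M" if "i < n" for i
    using F_measurable_M[OF _ Y_F[OF that]] \<tau>0[of "Suc i"] that by auto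
  \<comment> \<open>The event of the first \<open>k\<close> increments belongs to
    \<open>F (\<tau> k)\<close>, so the next increment factors off. Membership in the filtration is
    part of the induction, and the extra intersection with \<open>space M\<close> handles
    \<open>k = 0\<close>.\<close>
  have key: "(\<Inter>i<k. Y i -` B i \<inter> space M) \<inter> space M \<in> sets (F (\<tau> k)) \<and>
      prob ((\<Inter>i<k. Y i -` B i \<inter> space M) \<inter> space M) = (\<Prod>i<k. prob (Y i -` B i \<inter> space M))"
    if "k \<le> n" "\<And>i. i < k \<Longrightarrow> B i \<in> sets borel" for k B
    using that
  proof (induction k)
    case 0
    then show ?case using space_F[of "\<tau> 0"] \<tau> sets.top[of "F (\<tau> 0)"] by (simp add: prob_space)
  next
    case (Suc k)
    let ?C = "(\<Inter>i<k. Y i -` B i \<inter> space M) \<inter> space M"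
    have IH: "?C \<in> sets (F (\<tau> k))" "prob ?C = (\<Prod>i<k. prob (Y i -` B i \<inter> space M))"
      using Suc by auto
    have k: "k < n" "0 \<le> \<tau> k" "\<tau> k \<le> \<tau> (Suc k)" using Suc \<tau> \<tau>0[of k] by auto
    have eq: "(\<Inter>i<Suc k. Y i -` B i \<inter> space M) \<inter> space M = ?C \<inter> (Y k -` B k \<inter> space M)"
      by (auto simp: less_Suc_eq)
    have "Y k -` B k \<inter> space M \<in> sets (F (\<tau> (Suc k)))"
      using measurable_sets[OF Y_F[OF k(1)], of "B k"] Suc.prems space_F[of "\<tau> (Suc k)"] k by auto
    moreover have "?C \<in> sets (F (\<tau> (Suc k)))" using F_mono[OF k(2,3)] IH(1) by blast
    moreover have "prob (?C \<inter> (Y k -` B k \<inter> space M)) = prob ?C * prob (Y k -` B k \<inter> space M)"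
      unfolding Y_def
      by (rule increment_independent[OF k(2,3) _ IH(1)[unfolded Y_def]]) (use v Suc.prems in auto)
    ultimately show ?case unfolding eq using IH(2) by simp
  qed
  have "indep_vars (\<lambda>_. borel) Y {..<n}"
  \<comment> \<open>The product criterion for independence concerns nonempty index sets.\<close>
  proof (cases "n = 0")
    case True
    then show ?thesis by (simp add: indep_vars_def indep_sets_def)
  next
    case False
    show ?thesis
    proof (subst indep_vars_finite[where E = "\<lambda>_. sets borel"], safe)
      fix B assume B: "B \<in> {..<n} \<rightarrow> sets (borel :: real measure)"
      have "(\<Inter>i<n. Y i -` B i \<inter> space M) = (\<Inter>i<n. Y i -` B i \<inter> space M) \<inter> space M"
        using False by auto
      then show "prob (\<Inter>i<n. Y i -` B i \<inter> space M) = (\<Prod>i<n. prob (Y i -` B i \<inter> space M))"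
        using key[of n B] B by (metis Pi_mem lessThan_iff order_refl)
    qed (use False Y_M sets.sigma_sets_eq[of "borel :: real measure"] sets.Int_stable in auto)
  qed
  then have "indep_vars (\<lambda>_. borel) (\<lambda>i \<omega>. (\<lambda>x. x / sqrt v) (Y i \<omega>)) {..<n}"
    by (rule indep_vars_compose2) simp
  then show "indep_vars (\<lambda>_. borel) (\<lambda>i \<omega>. (R (\<tau> (Suc i)) \<omega> - R 0 \<omega>) / sqrt v - (R (\<tau> i) \<omega> - R 0 \<omega>) / sqrt v) {..<n}"
    by (simp add: Y_def diff_divide_distrib)
qed simp

end

section \<open>The natural filtration\<close>

text \<open>Equality is assumed on \<open>space M\<close> only, because rewriting the compensator
  relies on continuity of the paths, which is known just there.\<close>

lemma (in filtered_prob_space) martingale_cong: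
  assumes N: "martingale M F N" and eq: "\<And>t \<omega>. \<lbrakk>0 \<le> t; \<omega> \<in> space M\<rbrakk> \<Longrightarrow> N t \<omega> = N' t \<omega>"
  shows "martingale M F N'"
  unfolding martingale_def
proof (intro conjI allI impI)
  fix t :: real assume t: "0 \<le> t"
  show "N' t \<in> borel_measurable (F t)"
  proof -
    have "N t \<in> borel_measurable (F t) \<longleftrightarrow> N' t \<in> borel_measurable (F t)"
      by (rule measurable_cong) (simp only: eq t space_F)
    then show ?thesis using N t by (simp add: martingale_def)
  qed
  show "integrable M (N' t)"
  proof -
    have "integrable M (N t) \<longleftrightarrow> integrable M (N' t)"
      by (rule Bochner_Integration.integrable_cong[OF refl]) (simp only: eq t)
    then show ?thesis using N t by (simp add: martingale_def)
  qed
next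
  fix s t :: real assume st: "0 \<le> s \<and> s \<le> t"
  interpret finite_measure_subalgebra M "F s"
    using subalgebra_F[OF st[THEN conjunct1]] by unfold_locales
  have t: "0 \<le> t" using st by simp
  have Nt: "N t \<in> borel_measurable M" using N t by (rule martingale_measurable)
  moreover have "N' t \<in> borel_measurable M"
  proof -
    have "N t \<in> borel_measurable M \<longleftrightarrow> N' t \<in> borel_measurable M"
      by (rule measurable_cong) (simp only: eq t)
    then show ?thesis using Nt by simp
  qed
  ultimately have "AE \<omega> in M. real_cond_exp M (F s) (N t) \<omega> = real_cond_exp M (F s) (N' t) \<omega>"
    by (intro real_cond_exp_cong AE_I2) (simp only: eq t)
  moreover have "AE \<omega> in M. real_cond_exp M (F s) (N t) \<omega> = N s \<omega>"
    using N st by (auto simp: martingale_def)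
  moreover have "AE \<omega> in M. N s \<omega> = N' s \<omega>" by (rule AE_I2) (use st in \<open>simp only: eq\<close>)
  ultimately show "AE \<omega> in M. real_cond_exp M (F s) (N' t) \<omega> = N' s \<omega>"
    by eventually_elim simp
qed

lemma filtered_prob_space_natural_filtration:
  fixes Z :: "real \<Rightarrow> 'w \<Rightarrow> 'b::topological_space"
  assumes "prob_space M" and Z: "\<And>t. t \<ge> 0 \<Longrightarrow> Z t \<in> borel_measurable M"
  shows "filtered_prob_space M (natural_filtration M Z)"
proof -
  interpret prob_space M by fact
  let ?G = "\<lambda>t. {Z s -` A \<inter> space M | s A. 0 \<le> s \<and> s \<le> t \<and> A \<in> sets borel}"
  have sets: "sets (natural_filtration M Z t) = sigma_sets (space M) (?G t)" for t
    unfolding natural_filtration_def by (rule sets_measure_of) auto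
  have "subalgebra M (natural_filtration M Z t)" for t
  proof -
    have "?G t \<subseteq> sets M" using Z by (auto intro: measurable_sets)
    then have "sets (natural_filtration M Z t) \<subseteq> sets M"
      unfolding sets by (rule sets.sigma_sets_subset)
    then show ?thesis
      by (simp add: subalgebra_def natural_filtration_def space_measure_of_conv)
  qed
  moreover have "sets (natural_filtration M Z s) \<subseteq> sets (natural_filtration M Z t)" if "s \<le> t" for s t
  proof -
    have "?G s \<subseteq> ?G t" using order_trans[OF _ that] by blast
    then show ?thesis unfolding sets by (rule sigma_sets_mono')
  qed
  ultimately show ?thesis
    by (intro filtered_prob_space.intro filtered_prob_space_axioms.intro assms(1))
qed

lemma measurable_natural_filtration:
  fixes Z :: "real \<Rightarrow> 'w \<Rightarrow> 'b::topological_space"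
  assumes "0 \<le> t"
  shows "Z t \<in> borel_measurable (natural_filtration M Z t)"
proof (rule measurableI)
  fix A :: "'b set" assume "A \<in> sets borel"
  then have "Z t -` A \<inter> space M \<in> {Z s -` A \<inter> space M | s A. 0 \<le> s \<and> s \<le> t \<and> A \<in> sets borel}"
    using assms by blast
  then show "Z t -` A \<inter> space (natural_filtration M Z t) \<in> sets (natural_filtration M Z t)"
    unfolding natural_filtration_def space_measure_of_conv
    by (subst sets_measure_of) (auto intro: sigma_sets.Basic)
qed simp

section \<open>Initial values, rational times and the Langevin equation\<close>

text \<open>For large \<open>n\<close> the argument lies in \<open>[-1, 1]\<close>, where the cosine
  equals 1 only at 0. It recovers the initial value from bounded test functions.\<close>

lemma eq_zero_if_cos_eq_1:
  assumes "\<And>n. cos (y / real (Suc n)) = 1"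
  shows "y = 0"
proof -
  obtain n :: nat where "\<bar>y\<bar> < real n" using reals_Archimedean2 by blast
  then have "\<bar>y / real (Suc n)\<bar> \<le> 1" by (simp add: abs_divide field_simps)
  then have "\<bar>y / real (Suc n)\<bar> \<le> pi" using pi_ge_two by linarith
  then have "\<bar>y / real (Suc n)\<bar> = 0"
    by (rule cos_inj_pi[OF abs_ge_zero _ order_refl pi_ge_zero]) (simp only: cos_abs_real assms cos_zero)
  then show ?thesis by simp
qed

text \<open>Positive rationals are dense in the open half-line, where density passes to an
  intersection; the endpoint 0 is itself rational.\<close>

lemma continuous_on_constant_if_Rats:
  fixes f :: "real \<Rightarrow> real"
  assumes cont: "continuous_on {0..} f" and eq: "\<And>q. q \<in> \<rat> \<Longrightarrow> 0 \<le> q \<Longrightarrow> f q = b" and "0 \<le> t"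
  shows "f t = b"
proof (cases "t = 0")
  case False
  have "{0<..} \<inter> closure \<rat> \<subseteq> closure ({0<..} \<inter> (\<rat> :: real set))"
    by (rule open_Int_closure_subset) simp
  then have t: "t \<in> closure ({0<..} \<inter> \<rat>)" using False \<open>0 \<le> t\<close> by (auto simp: Rats_closure_real)
  have "closure ({0<..} \<inter> \<rat>) \<subseteq> {0::real..}" by (rule closure_minimal) auto
  then show ?thesis
    by (intro continuous_constant_on_closure[OF continuous_on_subset[OF cont] _ t]) (auto intro: eq)
qed (use eq[of 0] in simp)

theorem proposition4p9:
  fixes M :: "'w measure" and Z :: "real \<Rightarrow> 'w \<Rightarrow> tempered"
    and \<sigma> c :: real and \<mu> :: tempered
  assumes "prob_space M"
    and "\<sigma> > 0"
    and "\<And>t. t \<ge> 0 \<Longrightarrow> Z t \<in> borel_measurable M"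
    and "\<And>\<omega>. \<omega> \<in> space M \<Longrightarrow> continuous_on {0..} (\<lambda>t. Z t \<omega>)"
    and "solves_martingale_problem M \<sigma> c \<mu> Z"
  shows "\<exists>B. brownian_motion M B \<and>
    (AE \<omega> in M. \<forall>t\<ge>0. \<forall>f.
      pairing (Z t \<omega>) f = pairing \<mu> f + \<sigma> * B t \<omega> * schwartz_fun f c
        + (LBINT s:{0..t}. pairing (Z s \<omega>) (schwartz_A f)))"
proof -
  define F where "F = natural_filtration M Z"
  interpret filtered_prob_space M F
    unfolding F_def using assms(1,3) by (rule filtered_prob_space_natural_filtration)
  define R where "R f t \<omega> = pairing (Z t \<omega>) f - (LBINT s:{0..t}. pairing (Z s \<omega>) (schwartz_A f))" for f t \<omega>
  have cont: "continuous_on {0..} (\<lambda>t. pairing (Z t \<omega>) f)" if "\<omega> \<in> space M" for \<omega> f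
    using continuous_on_compose2[OF continuous_on_pairing assms(4)[OF that]] by simp
  have cont': "continuous_on {0..t} (\<lambda>t. pairing (Z t \<omega>) f)" if "\<omega> \<in> space M" for \<omega> f t
    by (rule continuous_on_subset[OF cont[OF that]]) auto
  have meas: "(\<lambda>\<omega>. pairing (Z t \<omega>) f) \<in> borel_measurable (F t)" if "0 \<le> t" for t f
    unfolding F_def
    by (rule measurable_compose[OF measurable_natural_filtration[OF that]])
      (rule borel_measurable_continuous_onI[OF continuous_on_pairing])
  define N where "N f \<theta> \<phi> t \<omega> = cos (\<theta> * pairing (Z t \<omega>) f + \<phi>) - cos (\<theta> * pairing \<mu> f + \<phi>) -
      (LBINT r:{0..t}. - \<theta> * sin (\<theta> * pairing (Z r \<omega>) f + \<phi>) * pairing (Z r \<omega>) (schwartz_A f)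
        - \<theta>\<^sup>2 * (\<sigma>\<^sup>2 * (schwartz_fun f c)\<^sup>2) / 2 * cos (\<theta> * pairing (Z r \<omega>) f + \<phi>))" for f \<theta> \<phi> t \<omega>
  have null: "martingale_null_at_0 M F (\<lambda>t \<omega>. cos (\<theta> * pairing (Z t \<omega>) f + \<phi>) - cos (\<theta> * pairing \<mu> f + \<phi>)
      - (LBINT s:{0..t}. (- \<theta> * sin (\<theta> * pairing (Z s \<omega>) f + \<phi>)) * pairing (Z s \<omega>) (schwartz_A f))
      - \<sigma>\<^sup>2 / 2 * (LBINT s:{0..t}. (- \<theta>\<^sup>2 * cos (\<theta> * pairing (Z s \<omega>) f + \<phi>)) * (schwartz_fun f c)\<^sup>2))" for f \<theta> \<phi>
  proof -
    have d: "deriv (\<lambda>x. cos (\<theta> * x + \<phi>)) = (\<lambda>x. - \<theta> * sin (\<theta> * x + \<phi>))"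
      by (intro ext DERIV_imp_deriv) (auto intro!: derivative_eq_intros)
    have dd: "deriv (\<lambda>x. - \<theta> * sin (\<theta> * x + \<phi>)) = (\<lambda>x. - \<theta>\<^sup>2 * cos (\<theta> * x + \<phi>))"
      by (intro ext DERIV_imp_deriv) (auto intro!: derivative_eq_intros simp: power2_eq_square)
    show ?thesis
      using assms(5)[unfolded solves_martingale_problem_def, THEN spec[of _ "\<lambda>x. cos (\<theta> * x + \<phi>)"],
          THEN spec[of _ f], THEN mp, OF smooth_bounded_cos]
      unfolding d dd F_def .
  qed
  \<comment> \<open>The drift and second-order integrals are merged into the single integral of the
    locale; additivity uses integrability along the continuous path.\<close>
  have N_eq: "cos (\<theta> * pairing (Z t \<omega>) f + \<phi>) - cos (\<theta> * pairing \<mu> f + \<phi>)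
      - (LBINT s:{0..t}. (- \<theta> * sin (\<theta> * pairing (Z s \<omega>) f + \<phi>)) * pairing (Z s \<omega>) (schwartz_A f))
      - \<sigma>\<^sup>2 / 2 * (LBINT s:{0..t}. (- \<theta>\<^sup>2 * cos (\<theta> * pairing (Z s \<omega>) f + \<phi>)) * (schwartz_fun f c)\<^sup>2)
      = N f \<theta> \<phi> t \<omega>" if \<omega>: "\<omega> \<in> space M" for f \<theta> \<phi> t \<omega>
  proof -
    let ?p = "\<lambda>s. (- \<theta> * sin (\<theta> * pairing (Z s \<omega>) f + \<phi>)) * pairing (Z s \<omega>) (schwartz_A f)"
    let ?q = "\<lambda>s. (- \<theta>\<^sup>2 * cos (\<theta> * pairing (Z s \<omega>) f + \<phi>)) * (schwartz_fun f c)\<^sup>2"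
    have "- \<theta> * sin (\<theta> * pairing (Z s \<omega>) f + \<phi>) * pairing (Z s \<omega>) (schwartz_A f)
        - \<theta>\<^sup>2 * (\<sigma>\<^sup>2 * (schwartz_fun f c)\<^sup>2) / 2 * cos (\<theta> * pairing (Z s \<omega>) f + \<phi>)
        = ?p s + \<sigma>\<^sup>2 / 2 * ?q s" for s
      by (simp add: field_simps)
    then have "(LBINT s:{0..t}. - \<theta> * sin (\<theta> * pairing (Z s \<omega>) f + \<phi>) * pairing (Z s \<omega>) (schwartz_A f)
        - \<theta>\<^sup>2 * (\<sigma>\<^sup>2 * (schwartz_fun f c)\<^sup>2) / 2 * cos (\<theta> * pairing (Z s \<omega>) f + \<phi>))
        = (LBINT s:{0..t}. ?p s + \<sigma>\<^sup>2 / 2 * ?q s)" by (simp only:)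
    also have "\<dots> = (LBINT s:{0..t}. ?p s) + (LBINT s:{0..t}. \<sigma>\<^sup>2 / 2 * ?q s)"
      by (intro set_integral_add(2) borel_integrable_atLeastAtMost' continuous_intros cont' \<omega>)
    also have "(LBINT s:{0..t}. \<sigma>\<^sup>2 / 2 * ?q s) = \<sigma>\<^sup>2 / 2 * (LBINT s:{0..t}. ?q s)"
      by (rule set_integral_mult_right)
    finally show ?thesis unfolding N_def by (simp only: diff_diff_eq)
  qed
  have trig: "trigonometric_martingale_problem M F (\<lambda>t \<omega>. pairing (Z t \<omega>) f)
      (\<lambda>t \<omega>. pairing (Z t \<omega>) (schwartz_A f)) (pairing \<mu> f) (\<sigma>\<^sup>2 * (schwartz_fun f c)\<^sup>2)" for f
  proof unfold_locales
    fix \<theta> \<phi>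
    have "martingale M F (N f \<theta> \<phi>)"
      by (rule martingale_cong[OF null[unfolded martingale_null_at_0_def, THEN conjunct1] N_eq])
    then show "martingale M F (\<lambda>t \<omega>. cos (\<theta> * pairing (Z t \<omega>) f + \<phi>) - cos (\<theta> * pairing \<mu> f + \<phi>) -
      (LBINT r:{0..t}. - \<theta> * sin (\<theta> * pairing (Z r \<omega>) f + \<phi>) * pairing (Z r \<omega>) (schwartz_A f)
        - \<theta>\<^sup>2 * (\<sigma>\<^sup>2 * (schwartz_fun f c)\<^sup>2) / 2 * cos (\<theta> * pairing (Z r \<omega>) f + \<phi>)))"
      by (simp add: N_def[abs_def])
  qed (use meas cont in auto)
  have R_cont: "continuous_on {0..} (\<lambda>t. R f t \<omega>)" if "\<omega> \<in> space M" for f \<omega>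
  proof -
    interpret T: trigonometric_martingale_problem M F "\<lambda>t \<omega>. pairing (Z t \<omega>) f"
      "\<lambda>t \<omega>. pairing (Z t \<omega>) (schwartz_A f)" "pairing \<mu> f" "\<sigma>\<^sup>2 * (schwartz_fun f c)\<^sup>2" by (rule trig)
    show ?thesis using T.R_cont[OF that] by (simp add: T.R_def R_def)
  qed
  have R_0: "AE \<omega> in M. R f 0 \<omega> = pairing \<mu> f" for f
  proof -
    have LB0: "(LBINT s:{0..0}. h s) = 0" for h :: "real \<Rightarrow> real"
    proof -
      have "(LBINT s:{0..0}. h s) = integral {0..0} h" by (rule LBINT_continuous) simp
      then show ?thesis using integral_refl[of 0 h] by (simp only: box_real)
    qed
    \<comment> \<open>The phase is chosen so that the test function equals \<open>cos 0\<close> at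
      \<open>pairing \<mu> f\<close>. At time 0 both integrals vanish, and being null at 0 leaves
      this identity.\<close>
    have "AE \<omega> in M. cos ((pairing (Z 0 \<omega>) f - pairing \<mu> f) / real (Suc n)) = 1" for n
    proof -
      define m where "m = real (Suc n)"
      have arg: "1 / m * x + - pairing \<mu> f / m = (x - pairing \<mu> f) / m" for x
        by (simp only: diff_divide_distrib) simp
      have "AE \<omega> in M. cos (1 / m * pairing (Z 0 \<omega>) f + - pairing \<mu> f / m)
          - cos (1 / m * pairing \<mu> f + - pairing \<mu> f / m) - 0 - \<sigma>\<^sup>2 / 2 * 0 = 0"
        using null[of "1 / m" f "- pairing \<mu> f / m"]
        unfolding martingale_null_at_0_def LB0 by (rule conjunct2)
      then have "AE \<omega> in M. cos ((pairing (Z 0 \<omega>) f - pairing \<mu> f) / m) - cos 0 = 0"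
        by (simp only: arg diff_self div_0 mult_zero_right diff_zero)
      then show ?thesis by (simp only: m_def cos_zero right_minus_eq)
    qed
    then have "AE \<omega> in M. \<forall>n. cos ((pairing (Z 0 \<omega>) f - pairing \<mu> f) / real (Suc n)) = 1"
      by (intro AE_all_countable[THEN iffD2] allI)
    then show ?thesis
    proof eventually_elim
      case (elim \<omega>)
      have "pairing (Z 0 \<omega>) f - pairing \<mu> f = 0"
        by (rule eq_zero_if_cos_eq_1) (rule elim[rule_format])
      then show ?case unfolding R_def LB0 by simp
    qed
  qed
  obtain f0 where f0: "schwartz_fun f0 c = 1" by (rule exists_schwartz_one_at)
  \<comment> \<open>Since \<open>f0\<close> has value 1 at \<open>c\<close>, its variance rate is
    \<open>\<sigma>\<^sup>2\<close>. This one process drives the equation for every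
    \<open>f\<close>.\<close>
  define B where "B t \<omega> = (R f0 t \<omega> - R f0 0 \<omega>) / \<sigma>" for t \<omega>
  have "brownian_motion M B"
  proof -
    interpret T: trigonometric_martingale_problem M F "\<lambda>t \<omega>. pairing (Z t \<omega>) f0"
      "\<lambda>t \<omega>. pairing (Z t \<omega>) (schwartz_A f0)" "pairing \<mu> f0" "\<sigma>\<^sup>2 * (schwartz_fun f0 c)\<^sup>2" by (rule trig)
    show ?thesis using T.brownian_motion_R \<open>\<sigma> > 0\<close> f0 by (simp add: T.R_def R_def B_def[abs_def])
  qed
  have each: "AE \<omega> in M. \<forall>t\<ge>0. R f t \<omega> = pairing \<mu> f + \<sigma> * B t \<omega> * schwartz_fun f c" for f
  proof -
    define h where "h = f - schwartz_fun f c *\<^sub>R f0"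
    have h0: "schwartz_fun h c = 0"
      using higher_deriv_schwartz_diff[of 0 f "schwartz_fun f c *\<^sub>R f0" c] f0
      by (simp add: h_def scaleR_schwartz.rep_eq)
    have pair_h: "pairing u h = pairing u f - schwartz_fun f c * pairing u f0"
      "pairing u (schwartz_A h) = pairing u (schwartz_A f) - schwartz_fun f c * pairing u (schwartz_A f0)" for u
      by (simp_all add: h_def schwartz_A_diff schwartz_A_scaleR linear_diff[OF linear_pairing] linear_scale[OF linear_pairing])
    have R_h: "R h t \<omega> = R f t \<omega> - schwartz_fun f c * R f0 t \<omega>" if \<omega>: "\<omega> \<in> space M" for t \<omega>
    proof -
      have "(LBINT s:{0..t}. pairing (Z s \<omega>) (schwartz_A f) - schwartz_fun f c * pairing (Z s \<omega>) (schwartz_A f0))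
          = (LBINT s:{0..t}. pairing (Z s \<omega>) (schwartz_A f)) - (LBINT s:{0..t}. schwartz_fun f c * pairing (Z s \<omega>) (schwartz_A f0))"
        by (intro set_integral_diff(2) borel_integrable_atLeastAtMost' continuous_intros cont' \<omega>)
      then show ?thesis unfolding R_def pair_h by (simp add: algebra_simps)
    qed
    have "AE \<omega> in M. R h q \<omega> = R h 0 \<omega>" if "0 \<le> q" for q
    proof -
      interpret T: trigonometric_martingale_problem M F "\<lambda>t \<omega>. pairing (Z t \<omega>) h"
        "\<lambda>t \<omega>. pairing (Z t \<omega>) (schwartz_A h)" "pairing \<mu> h" "\<sigma>\<^sup>2 * (schwartz_fun h c)\<^sup>2" by (rule trig)
      have "AE \<omega> in M. T.R q \<omega> = T.R 0 \<omega>"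
        by (rule T.increment_zero[OF order_refl that]) (simp add: h0)
      then show ?thesis by (simp only: T.R_def R_def)
    qed
    \<comment> \<open>The exceptional set depends on the time, so rational times are collected
      first; continuity of \<open>R h\<close> then reaches all \<open>t\<close>.\<close>
    then have "AE \<omega> in M. \<forall>q\<in>\<rat> \<inter> {0..}. R h q \<omega> = R h 0 \<omega>"
      by (intro AE_ball_countable[THEN iffD2, OF countable_Int1[OF countable_rat]] ballI) simp
    then show ?thesis
      using R_0[of f] R_0[of f0] AE_space
    proof eventually_elim
      case (elim \<omega>)
      show ?case
      proof (intro allI impI)
        fix t :: real assume "0 \<le> t"
        have "R h t \<omega> = R h 0 \<omega>"
          by (rule continuous_on_constant_if_Rats[OF R_cont[OF elim(4)] _ \<open>0 \<le> t\<close>])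
            (rule elim(1)[rule_format], simp)
        then have "R f t \<omega> = R f 0 \<omega> + (R f0 t \<omega> - R f0 0 \<omega>) * schwartz_fun f c"
          unfolding R_h[OF elim(4)] by (simp add: algebra_simps)
        moreover have "R f0 t \<omega> - R f0 0 \<omega> = \<sigma> * B t \<omega>"
          using \<open>\<sigma> > 0\<close> by (simp add: B_def)
        ultimately show "R f t \<omega> = pairing \<mu> f + \<sigma> * B t \<omega> * schwartz_fun f c"
          by (simp only: elim(2))
      qed
    qed
  qed
  obtain D :: "schwartz set" where D: "countable D" "\<And>f. \<exists>g. range g \<subseteq> D \<and> schwartz_LIMSEQ g f"
    by (rule countable_dense_schwartz) (rule that, assumption, blast)
  \<comment> \<open>The null set in \<open>each\<close> depends on \<open>f\<close>; a countable
    union is taken over \<open>D\<close>, and limits along sequences in \<open>D\<close> remove the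
    restriction without enlarging it.\<close>
  have "AE \<omega> in M. \<forall>f\<in>D. \<forall>t\<ge>0. R f t \<omega> = pairing \<mu> f + \<sigma> * B t \<omega> * schwartz_fun f c"
    by (intro AE_ball_countable[THEN iffD2, OF D(1)] ballI each)
  then have "AE \<omega> in M. \<forall>t\<ge>0. \<forall>f. pairing (Z t \<omega>) f = pairing \<mu> f + \<sigma> * B t \<omega> * schwartz_fun f c
        + (LBINT s:{0..t}. pairing (Z s \<omega>) (schwartz_A f))"
    using AE_space
  proof eventually_elim
    case (elim \<omega>)
    show ?case
    proof (intro allI impI)
      fix t :: real and f assume t: "0 \<le> t"
      obtain g where g: "range g \<subseteq> D" "schwartz_LIMSEQ g f" using D(2) by blast
      have Zc: "continuous_on {0..t} (\<lambda>s. Z s \<omega>)"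
        by (rule continuous_on_subset[OF assms(4)[OF elim(2)]]) auto
      have "(\<lambda>n. R (g n) t \<omega>) \<longlonglongrightarrow> R f t \<omega>"
        unfolding R_def
        by (intro tendsto_diff pairing_LIMSEQ g integral_pairing_LIMSEQ[OF Zc] schwartz_LIMSEQ_A)
      moreover have "(\<lambda>n. R (g n) t \<omega>) = (\<lambda>n. pairing \<mu> (g n) + \<sigma> * B t \<omega> * schwartz_fun (g n) c)"
      proof
        fix n
        have "g n \<in> D" using g(1) by auto
        with elim(1) t show "R (g n) t \<omega> = pairing \<mu> (g n) + \<sigma> * B t \<omega> * schwartz_fun (g n) c" by simp
      qed
      moreover have "(\<lambda>n. pairing \<mu> (g n) + \<sigma> * B t \<omega> * schwartz_fun (g n) c)
          \<longlonglongrightarrow> pairing \<mu> f + \<sigma> * B t \<omega> * schwartz_fun f c"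
        by (intro tendsto_intros pairing_LIMSEQ schwartz_LIMSEQ_eval g)
      ultimately have "R f t \<omega> = pairing \<mu> f + \<sigma> * B t \<omega> * schwartz_fun f c"
        by (metis LIMSEQ_unique)
      then show "pairing (Z t \<omega>) f = pairing \<mu> f + \<sigma> * B t \<omega> * schwartz_fun f c
          + (LBINT s:{0..t}. pairing (Z s \<omega>) (schwartz_A f))"
        by (simp add: R_def)
    qed
  qed
  with \<open>brownian_motion M B\<close> show ?thesis by blast
qed

end
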